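(* Let $d\in\mathbb{N}$ and let $(S_t)_{t\geq 0}$ be the Ornstein–Uhlenbeck semigroup on $C_b(\mathbb{R}^d)$, i.e. $S_0f:=f$ and $S_tf:=\int_{\mathbb{R}^d}M_t(\cdot,y)f(y)\,\mathrm{d}y$ for $t>0$ and $f\in C_b(\mathbb{R}^d)$, where $$M_t(x,y):=\frac{1}{\pi^{d/2}(1-e^{-2t})^{d/2}}e^{-|y-e^{-t}x|^2/(1-e^{-2t})}\qquad(t>0,\ x,y\in\mathbb{R}^d).$$ Let $\Omega\subseteq\mathbb{R}^d$ be thick and let $C:C_b(\mathbb{R}^d)\to C_b(\Omega)$, $Cf:=f|_\Omega$. Then for every $T>0$ and $r\in[1,\infty]$ there exists $C_{\mathrm{obs}}\geq 0$ such that for all $f\in C_b(\mathbb{R}^d)$ $$\|S_Tf\|_{C_b(\mathbb{R}^d)}\leq\begin{cases} C_{\mathrm{obs}}\left(\int_0^T\|CS_tf\|_{C_b(\Omega)}^r\,\mathrm{d}t\right)^{1/r} & \text{if } r\in[1,\infty),\\ C_{\mathrm{obs}}\,\operatorname{ess\,sup}_{t\in[0,T]}\|CS_tf\|_{C_b(\Omega)} & \text{if } r=\infty.\end{cases}$$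
   Context: $C_b(Z)$ denotes the space of bounded continuous scalar-valued functions on $Z$ with the supremum norm. A set $\Omega\subseteq\mathbb{R}^d$ is called thick if $\Omega$ is (Lebesgue) measurable and there exist $L=(L_1,\dots,L_d)\in(0,\infty)^d$ and $\rho\in(0,1]$ such that $\lambda^d(\Omega\cap(x+(0,L)))\geq\rho\,\lambda^d((0,L))$ for all $x\in\mathbb{R}^d$, where $\lambda^d$ is $d$-dimensional Lebesgue measure and $(0,L):=\prod_{j=1}^d(0,L_j)$. *)

theory Defs
  imports "HOL-Probability.Probability"
begin

definition thick :: "(real ^ 'd) set \<Rightarrow> bool" where
  "thick \<Omega> \<longleftrightarrow> \<Omega> \<in> sets lebesgue \<and>
     (\<exists>L \<rho>. (\<forall>j. 0 < L $ j) \<and> 0 < \<rho> \<and> \<rho> \<le> 1 \<and>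
        (\<forall>x. measure lebesgue (\<Omega> \<inter> (+) x ` box 0 L) \<ge> \<rho> * measure lebesgue (box 0 L)))"

definition mehler :: "real \<Rightarrow> real ^ 'd \<Rightarrow> real ^ 'd \<Rightarrow> real" where
  "mehler t x y =
     1 / (pi powr (CARD('d) / 2) * (1 - exp (- 2 * t)) powr (CARD('d) / 2)) *
     exp (- (norm (y - exp (- t) *\<^sub>R x))\<^sup>2 / (1 - exp (- 2 * t)))"

lemma mehler_nonneg: "0 \<le> mehler t x y"
  by (simp add: mehler_def)

lemma mehler_shift: "mehler t x (exp (- t) *\<^sub>R x + z) = mehler t 0 z"
  by (simp add: mehler_def)

lemma borel_measurable_mehler [measurable]: "mehler t x \<in> borel_measurable borel"
  unfolding mehler_def by measurable

lemma integrable_exp_norm_square: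
  fixes c :: real
  assumes "c > 0"
  shows "integrable lborel (\<lambda>z :: 'a::euclidean_space. exp (- (norm z)\<^sup>2 / c))"
proof (rule integrableI_nonneg)
  have "exp (- u\<^sup>2 / c) = sqrt (pi * c) * normal_density 0 (sqrt (c / 2)) u" for u
    using assms by (simp add: normal_density_def)
  then have "integrable lborel (\<lambda>u::real. exp (- u\<^sup>2 / c))"
    using assms by simp
  then have fin: "(\<integral>\<^sup>+u. exp (- (u::real)\<^sup>2 / c) \<partial>lborel) < \<infinity>"
    by (simp add: integrable_iff_bounded)
  have "exp (- (norm z)\<^sup>2 / c) = (\<Prod>b\<in>Basis. exp (- (z \<bullet> b)\<^sup>2 / c))" for z :: 'a
    by (simp add: exp_sum [symmetric] norm_eq_sqrt_inner euclidean_inner [of z z]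
          power2_eq_square [symmetric] sum_nonneg sum_negf sum_divide_distrib)
  then have "(\<integral>\<^sup>+z. exp (- (norm (z::'a))\<^sup>2 / c) \<partial>lborel) =
      (\<integral>\<^sup>+z. (\<Prod>b\<in>Basis. ennreal (exp (- ((z::'a) \<bullet> b)\<^sup>2 / c))) \<partial>lborel)"
    by (simp add: prod_ennreal)
  also have "\<dots> = (\<Prod>b\<in>(Basis::'a set). (\<integral>\<^sup>+u. exp (- (u::real)\<^sup>2 / c) \<partial>lborel))"
    by (subst nn_integral_lborel_prod) auto
  also have "\<dots> < \<infinity>"
    using fin by (simp add: power_less_top_ennreal)
  finally show "(\<integral>\<^sup>+z. exp (- (norm (z::'a))\<^sup>2 / c) \<partial>lborel) < \<infinity>" .
qed auto

lemma integrable_mehler: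
  assumes "t > 0"
  shows "integrable lborel (mehler t (0 :: real ^ 'd))"
proof -
  have "integrable lborel (\<lambda>z :: real ^ 'd. exp (- (norm z)\<^sup>2 / (1 - exp (- 2 * t))))"
    using assms by (intro integrable_exp_norm_square) simp
  then show ?thesis
    unfolding mehler_def by simp
qed

lemma integral_mehler_shift:
  fixes f :: "real ^ 'd \<Rightarrow> 'k::{banach, second_countable_topology}"
  assumes [measurable]: "f \<in> borel_measurable borel"
  shows "(\<integral>y. mehler t x y *\<^sub>R f y \<partial>lborel) =
    (\<integral>z. mehler t 0 z *\<^sub>R f (exp (- t) *\<^sub>R x + z) \<partial>lborel)"
  by (subst lborel_distr_plus [of "exp (- t) *\<^sub>R x", symmetric], subst integral_distr)
     (auto simp: mehler_shift)

lemma bcontfun_mehler_integral: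
  fixes f :: "real ^ 'd \<Rightarrow> 'k::{banach, second_countable_topology}"
  assumes f: "f \<in> bcontfun" and t: "t > 0"
  shows "(\<lambda>x. \<integral>y. mehler t x y *\<^sub>R f y \<partial>lborel) \<in> bcontfun"
proof -
  have cont: "continuous_on UNIV f" and "bounded (range f)"
    using f by (auto simp: bcontfun_def)
  then obtain B where B: "\<And>y. norm (f y) \<le> B"
    by (auto simp: bounded_iff)
  have [measurable]: "f \<in> borel_measurable borel"
    using cont by (rule borel_measurable_continuous_onI)
  have int: "integrable lborel (\<lambda>z :: real ^ 'd. B * mehler t 0 z)"
    using integrable_mehler [OF t, where ?'d = 'd] by simp
  have bound: "norm (mehler t 0 z *\<^sub>R f (exp (- t) *\<^sub>R x + z)) \<le> B * mehler t 0 z" for x z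
    using mult_left_mono [OF B mehler_nonneg, of t 0 z "exp (- t) *\<^sub>R x + z"]
    by (simp add: mehler_nonneg mult.commute)
  let ?g = "\<lambda>x. \<integral>z. mehler t 0 z *\<^sub>R f (exp (- t) *\<^sub>R x + z) \<partial>lborel"
  have "(\<lambda>n. ?g (u n)) \<longlonglongrightarrow> ?g x" if u: "u \<longlonglongrightarrow> x" for u x
  proof (rule integral_dominated_convergence [OF _ _ int])
    show "AE z in lborel. (\<lambda>n. mehler t 0 z *\<^sub>R f (exp (- t) *\<^sub>R u n + z))
        \<longlonglongrightarrow> mehler t 0 z *\<^sub>R f (exp (- t) *\<^sub>R x + z)"
    proof (rule AE_I2)
      fix z
      have "isCont f (exp (- t) *\<^sub>R x + z)"
        using cont by (simp add: continuous_on_eq_continuous_at)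
      moreover have "(\<lambda>n. exp (- t) *\<^sub>R u n + z) \<longlonglongrightarrow> exp (- t) *\<^sub>R x + z"
        by (intro tendsto_intros u)
      ultimately have "(\<lambda>n. f (exp (- t) *\<^sub>R u n + z)) \<longlonglongrightarrow> f (exp (- t) *\<^sub>R x + z)"
        by (rule isCont_tendsto_compose)
      then show "(\<lambda>n. mehler t 0 z *\<^sub>R f (exp (- t) *\<^sub>R u n + z))
          \<longlonglongrightarrow> mehler t 0 z *\<^sub>R f (exp (- t) *\<^sub>R x + z)"
        by (intro tendsto_intros)
    qed
  qed (use bound in auto)
  then have "continuous_on UNIV ?g"
    by (auto simp: continuous_on_sequentially o_def)
  moreover have "norm (?g x) \<le> (\<integral>z. B * mehler t 0 z \<partial>(lborel :: (real ^ 'd) measure))" for x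
    using bound int by (intro Bochner_Integration.integral_norm_bound_integral
      Bochner_Integration.integrable_bound [OF int]) (auto intro: order_trans [OF _ abs_ge_self])
  then have "bounded (range ?g)"
    by (auto simp: bounded_iff)
  ultimately have "?g \<in> bcontfun"
    by (simp add: bcontfun_def)
  moreover have "(\<lambda>x. \<integral>y. mehler t x y *\<^sub>R f y \<partial>lborel) = ?g"
    by (intro ext integral_mehler_shift) measurable
  ultimately show ?thesis
    by (simp only:)
qed

text \<open>For \<open>t < 0\<close> the value of the semigroup is irrelevant. The scalars are real or complex;
  both cases are covered by types of class \<^class>\<open>real_normed_field\<close> and
  \<^class>\<open>euclidean_space\<close>.\<close>

definition ou_semigroup ::
    "real \<Rightarrow> ((real ^ 'd) \<Rightarrow>\<^sub>C 'k::{banach, second_countable_topology}) \<Rightarrow> ((real ^ 'd) \<Rightarrow>\<^sub>C 'k)" where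
  "ou_semigroup t f =
     (if t > 0 then Bcontfun (\<lambda>x. \<integral>y. mehler t x y *\<^sub>R f y \<partial>lborel) else f)"

lemma ou_semigroup_0: "ou_semigroup 0 f = f"
  by (simp add: ou_semigroup_def)

lemma apply_ou_semigroup:
  "t > 0 \<Longrightarrow> apply_bcontfun (ou_semigroup t f) x = (\<integral>y. mehler t x y *\<^sub>R f y \<partial>lborel)"
  using bcontfun_mehler_integral [OF apply_bcontfun, of t f]
  by (simp add: ou_semigroup_def Bcontfun_inverse)

text \<open>The space of bounded continuous functions on a subset \<open>Z\<close>; its elements take the value
  \<^const>\<open>undefined\<close> off \<open>Z\<close>. The norm is the supremum norm for \<open>Z \<noteq> {}\<close>, and thick sets
  are nonempty.\<close>

definition Cb :: "'a::topological_space set \<Rightarrow> ('a \<Rightarrow> 'k::real_normed_vector) set" where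
  "Cb Z = {g \<in> extensional Z. continuous_on Z g \<and> bounded (g ` Z)}"

definition Cb_norm :: "'a set \<Rightarrow> ('a \<Rightarrow> 'k::real_normed_vector) \<Rightarrow> real" where
  "Cb_norm Z g = (SUP z\<in>Z. norm (g z))"

definition observation ::
    "'a::topological_space set \<Rightarrow> ('a \<Rightarrow>\<^sub>C 'k::real_normed_vector) \<Rightarrow> 'a \<Rightarrow> 'k" where
  "observation \<Omega> f = restrict (apply_bcontfun f) \<Omega>"

lemma observation_in_Cb: "observation \<Omega> f \<in> Cb \<Omega>"
proof -
  have "bounded (apply_bcontfun f ` \<Omega>)"
    by (rule bounded_subset [OF bounded_apply_bcontfun]) auto
  then show ?thesis
    by (simp add: observation_def Cb_def)
qed

lemma thick_nonempty: "thick \<Omega> \<Longrightarrow> \<Omega> \<noteq> {}"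
proof
  assume "thick \<Omega>" "\<Omega> = {}"
  then obtain L :: "real ^ 'a" and \<rho> :: real where L: "\<And>j. 0 < L $ j" and "0 < \<rho>"
      and "\<rho> * measure lebesgue (box 0 L) \<le> 0"
    by (auto simp: thick_def)
  moreover have "measure lebesgue (box 0 L) > 0"
    using L by (auto simp: measure_lborel_box_eq Basis_vec_def inner_axis
        intro!: prod_pos less_imp_le)
  ultimately show False
    by (simp add: mult_le_0_iff)
qed

lemma norm_bcontfun_eq_Cb_norm: "norm f = Cb_norm UNIV (apply_bcontfun f)"
  by (simp add: norm_bcontfun_def dist_bcontfun_def Cb_norm_def)

end

theory Submission
  imports Defs "HOL-Computational_Algebra.Polynomial"
begin

text \<open>
  Let \<open>u = S\<^sub>\<tau> g\<close>. Averaging over \<open>v\<close> in the box of the thickness condition, every point \<open>x\<close>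
  admits a direction \<open>v\<close> such that a fixed proportion of the equispaced points
  \<open>x + (1 + i/m) v\<close>, \<open>i < m\<close>, lies in \<open>\<Omega>\<close>. Extrapolating \<open>u\<close> from \<open>2N\<close> of them to \<open>x\<close> by
  Lagrange interpolation costs a factor \<open>e\<^bsup>cN\<^esup>\<close>. The Mehler kernel is, along this line, a Gaussian
  times the exponential of a quadratic polynomial; the Taylor polynomials of the exponential make
  the extrapolation error as small as \<open>D e\<^bsup>D/\<tau>\<^esup> e\<^bsup>-3cN\<^esup> \<parallel>g\<parallel>\<close>, for a rate as large as one
  likes compared with \<open>c\<close>. Hence, for all \<open>0 < s < t \<le> T\<close> and \<open>N \<ge> 1\<close>,
  \<open>\<parallel>S\<^sub>t f\<parallel> \<le> e\<^bsup>cN\<^esup> \<parallel>C S\<^sub>t f\<parallel> + D e\<^bsup>D/(t-s)\<^esup> e\<^bsup>-3cN\<^esup> \<parallel>S\<^sub>s f\<parallel>\<close>.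
  Using this near the times \<open>T/2\<^sup>k\<close> with \<open>N\<close> proportional to \<open>2\<^sup>k\<close>, weighting and telescoping gives the
  observability estimate for \<open>r = 1\<close>, which implies the one for every other \<open>r\<close>.
\<close>

section \<open>Lagrange extrapolation and the exponential series\<close>

text \<open>The weights are the values at 0 of the Lagrange basis polynomials for the nodes
  \<open>s j\<close>. Interpolation at more nodes than the degree of \<open>p\<close> reproduces
  \<open>p\<close>, in particular its value at 0.\<close>

lemma lagrange_functional:
  fixes s :: "'a \<Rightarrow> real" and p :: "real poly"
  assumes "finite J" "inj_on s J" "degree p < card J"
  shows "(\<Sum>j\<in>J. (\<Prod>i\<in>J - {j}. s i / (s i - s j)) * poly p (s j)) = poly p 0"
proof -
  \<comment> \<open>Writing each linear factor as \<open>s i - X\<close> over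
    \<open>s i - s j\<close> makes its value at 0 exactly the factor of the weight.\<close>
  define l where "l j = (\<Prod>i\<in>J - {j}. smult (1 / (s i - s j)) [:s i, -1:])" for j
  define q where "q = (\<Sum>j\<in>J. smult (poly p (s j)) (l j))"
  have deg_l: "degree (l j) < card J" if "j \<in> J" for j
  proof -
    have "degree (l j) \<le> (\<Sum>i\<in>J - {j}. degree (smult (1 / (s i - s j)) [:s i, -1:]))"
      unfolding l_def using degree_prod_sum_le[of "J - {j}" "\<lambda>i. smult (1 / (s i - s j)) [:s i, -1:]"] assms(1) by (simp add: o_def)
    also have "\<dots> \<le> (\<Sum>i\<in>J - {j}. 1)"
      by (intro sum_mono) (auto intro: order_trans [OF degree_smult_le])
    also have "\<dots> < card J"
      using assms(1) that card_Diff1_less[of J j] by simp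
    finally show ?thesis .
  qed
  have l_eval: "poly (l j) (s k) = (if k = j then 1 else 0)" if "j \<in> J" "k \<in> J" for j k
  proof (cases "k = j")
    case True
    have "poly (smult (1 / (s i - s j)) [:s i, -1:]) (s j) = 1" if "i \<in> J - {j}" for i
    proof -
      have "s i - s j \<noteq> 0" using inj_onD[OF assms(2)] that \<open>j \<in> J\<close> by auto
      moreover have "poly (smult (1 / (s i - s j)) [:s i, -1:]) (s j) = (s i - s j) / (s i - s j)"
        by (simp add: diff_divide_distrib del: divide_self_if)
      ultimately show ?thesis by simp
    qed
    then show ?thesis
      unfolding l_def poly_prod True by simp
  next
    case False
    then show ?thesis
      using that assms(1) unfolding l_def poly_prod
      by (auto intro!: prod_zero bexI[of _ k])
  qed
  \<comment> \<open>Both polynomials have degree below \<open>card J\<close> and agree at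
    \<open>card J\<close> distinct nodes.\<close>
  have "q = p"
  proof (rule poly_eqI_degree [of "s ` J"])
    fix x assume "x \<in> s ` J"
    then obtain k where k: "k \<in> J" "x = s k" by auto
    have "poly q x = (\<Sum>j\<in>J. poly p (s j) * (if k = j then 1 else 0))"
      unfolding q_def poly_sum k(2) using k(1) by (intro sum.cong) (auto simp: l_eval)
    then show "poly q x = poly p x"
      using k assms(1) by (simp add: if_distrib sum.delta cong: if_cong)
  next
    have card: "card (s ` J) = card J" using assms(2) by (rule card_image)
    show "card (s ` J) > degree p" using assms(3) card by simp
    have "degree q \<le> card J - 1"
      unfolding q_def using deg_l assms(1)
      by (intro degree_sum_le) (auto intro!: order_trans[OF degree_smult_le] simp: le_diff_conv2 Suc_leI less_eq_Suc_le dest: deg_l)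
    then show "card (s ` J) > degree q" using assms(3) card by simp
  qed
  moreover have "poly q 0 = (\<Sum>j\<in>J. (\<Prod>i\<in>J - {j}. s i / (s i - s j)) * poly p (s j))"
    unfolding q_def poly_sum l_def by (intro sum.cong) (auto simp: poly_prod)
  ultimately show ?thesis by simp
qed

text \<open>The maximum of \<open>n\<close> distinct positive integers is at least \<open>n\<close>;
  removing it leaves the same situation for \<open>n - 1\<close>.\<close>

lemma fact_card_le_prod:
  fixes A :: "nat set"
  assumes "finite A" "0 \<notin> A"
  shows "fact (card A) \<le> \<Prod>A"
  using assms
proof (induction "card A" arbitrary: A)
  case 0
  then show ?case by simp
next
  case (Suc n)
  then have ne: "A \<noteq> {}" by auto
  define m where "m = Max A"
  have m: "m \<in> A" using Suc.prems ne by (simp add: m_def)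
  have "A \<subseteq> {1..m}"
    using Suc.prems by (auto simp: m_def Suc_le_eq intro: ccontr)
  then have "card A \<le> m"
    using card_mono[of "{1..m}" A] by simp
  moreover have "fact (card (A - {m})) \<le> \<Prod>(A - {m})"
    using Suc m by (intro Suc.hyps(1)) auto
  ultimately have "card A * fact (card (A - {m})) \<le> m * \<Prod>(A - {m})"
    by (intro mult_mono) auto
  moreover have "fact (card A) = card A * fact (card (A - {m}))"
    using Suc m by (simp flip: Suc.hyps(2))
  moreover have "\<Prod>A = m * \<Prod>(A - {m})"
    using Suc.prems m by (simp add: prod.remove)
  ultimately show ?case by simp
qed

text \<open>On each side of \<open>j\<close> the distances to \<open>j\<close> are distinct positive
  integers, so the product is at least \<open>p! * q!\<close> with
  \<open>p + q = card J - 1\<close>. The binomial coefficient \<open>(p + q)! / (p! * q!)\<close> is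
  at most \<open>2 ^ (p + q)\<close>.\<close>

lemma fact_le_prod_abs_diff:
  fixes J :: "nat set"
  assumes "finite J" "j \<in> J"
  shows "fact (card J - 1) / 2 ^ (card J - 1) \<le> (\<Prod>i\<in>J - {j}. \<bar>real i - real j\<bar>)"
proof -
  define P where "P = {i\<in>J. j < i}"
  define Q where "Q = {i\<in>J. i < j}"
  have JPQ: "J - {j} = P \<union> Q" and disj: "P \<inter> Q = {}" and fin: "finite P" "finite Q"
    using assms by (auto simp: P_def Q_def)
  have card: "card J - 1 = card P + card Q"
    using assms JPQ disj fin by (metis card_Diff_singleton card_Un_disjoint)
  have P: "fact (card P) \<le> (\<Prod>i\<in>P. \<bar>real i - real j\<bar>)"
  proof -
    have inj: "inj_on (\<lambda>i. i - j) P" by (auto simp: inj_on_def P_def)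
    have "fact (card ((\<lambda>i. i - j) ` P)) \<le> \<Prod>((\<lambda>i. i - j) ` P)"
      using fin by (intro fact_card_le_prod) (auto simp: P_def)
    then have "fact (card P) \<le> (\<Prod>i\<in>P. i - j)"
      using inj by (simp add: card_image prod.reindex)
    then have "real (fact (card P)) \<le> real (\<Prod>i\<in>P. i - j)" by (simp only: of_nat_le_iff)
    also have "\<dots> = (\<Prod>i\<in>P. \<bar>real i - real j\<bar>)"
      unfolding of_nat_prod by (intro prod.cong) (auto simp: P_def)
    finally show ?thesis by simp
  qed
  have Q: "fact (card Q) \<le> (\<Prod>i\<in>Q. \<bar>real i - real j\<bar>)"
  proof -
    have inj: "inj_on (\<lambda>i. j - i) Q" by (auto simp: inj_on_def Q_def)
    have "fact (card ((\<lambda>i. j - i) ` Q)) \<le> \<Prod>((\<lambda>i. j - i) ` Q)"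
      using fin by (intro fact_card_le_prod) (auto simp: Q_def)
    then have "fact (card Q) \<le> (\<Prod>i\<in>Q. j - i)"
      using inj by (simp add: card_image prod.reindex)
    then have "real (fact (card Q)) \<le> real (\<Prod>i\<in>Q. j - i)" by (simp only: of_nat_le_iff)
    also have "\<dots> = (\<Prod>i\<in>Q. \<bar>real i - real j\<bar>)"
      unfolding of_nat_prod by (intro prod.cong) (auto simp: Q_def)
    finally show ?thesis by simp
  qed
  have "fact (card P + card Q) = fact (card P) * fact (card Q) * (card P + card Q choose card P)"
    using binomial_fact_lemma[of "card P" "card P + card Q"] by simp
  also have "\<dots> \<le> fact (card P) * fact (card Q) * 2 ^ (card P + card Q)"
    by (intro mult_left_mono binomial_le_pow2) simp
  finally have "real (fact (card P + card Q)) \<le> real (fact (card P) * fact (card Q) * 2 ^ (card P + card Q))"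
    by (simp only: of_nat_le_iff)
  then have "fact (card J - 1) / 2 ^ (card J - 1) \<le> (fact (card P) * fact (card Q) :: real)"
    unfolding card by (simp add: field_simps)
  also have "\<dots> \<le> (\<Prod>i\<in>P. \<bar>real i - real j\<bar>) * (\<Prod>i\<in>Q. \<bar>real i - real j\<bar>)"
    using P Q by (intro mult_mono) (auto intro: prod_nonneg)
  also have "\<dots> = (\<Prod>i\<in>J - {j}. \<bar>real i - real j\<bar>)"
    unfolding JPQ using fin disj by (simp add: prod.union_disjoint)
  finally show ?thesis .
qed

lemma power_le_fact_mult_exp:
  fixes x :: real
  assumes "0 \<le> x"
  shows "x ^ n \<le> fact n * exp x"
proof -
  have "(\<Sum>k\<in>{n}. x ^ k /\<^sub>R fact k) \<le> (\<Sum>k. x ^ k /\<^sub>R fact k)"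
    using assms by (intro sum_le_suminf summable_exp_generic) auto
  then show ?thesis by (simp add: exp_def field_simps)
qed

text \<open>Clearing the denominators \<open>m\<close> turns each factor into
  \<open>(m + i) / \<bar>i - j\<bar>\<close> in absolute value. The numerators are at most
  \<open>2 * m\<close>, the denominators multiply to at least \<open>k! / 2 ^ k\<close> with
  \<open>k = card J - 1\<close>, and \<open>(4 * m) ^ k / k!\<close> is one term of the series of
  \<open>exp (4 * m)\<close>.\<close>

lemma lagrange_coefficient_sum_le:
  assumes "J \<subseteq> {..<m}"
  shows "(\<Sum>j\<in>J. \<bar>\<Prod>i\<in>J - {j}. (1 + real i / real m) / ((1 + real i / real m) - (1 + real j / real m))\<bar>)
    \<le> real (card J) * exp (4 * real m)"
proof -
  have fin: "finite J" using assms finite_subset by blast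
  have "\<bar>\<Prod>i\<in>J - {j}. (1 + real i / real m) / ((1 + real i / real m) - (1 + real j / real m))\<bar> \<le> exp (4 * real m)"
    if j: "j \<in> J" for j
  proof -
    let ?k = "card J - 1"
    have m: "m > 0" using j assms by auto
    have "\<bar>\<Prod>i\<in>J - {j}. (1 + real i / real m) / ((1 + real i / real m) - (1 + real j / real m))\<bar>
        = (\<Prod>i\<in>J - {j}. (real m + real i) / \<bar>real i - real j\<bar>)"
      unfolding abs_prod
    proof (intro prod.cong refl)
      fix i
      have cancel: "(A / M) / (B / M) = A / B" if "M \<noteq> 0" for A B M :: real
        using that by simp
      have "(1 + real i / m) / ((1 + real i / m) - (1 + real j / m)) = (real m + real i) / (real i - real j)"
      proof -
        have "1 + real i / m = (real m + real i) / m" "(1 + real i / m) - (1 + real j / m) = (real i - real j) / m"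
          using m by (simp_all add: field_simps)
        then have "(1 + real i / m) / ((1 + real i / m) - (1 + real j / m)) = ((real m + real i) / m) / ((real i - real j) / m)"
          by (simp only:)
        also have "\<dots> = (real m + real i) / (real i - real j)"
          using cancel[of "real m"] m by simp
        finally show ?thesis .
      qed
      then show "\<bar>(1 + real i / m) / ((1 + real i / m) - (1 + real j / m))\<bar> = (real m + real i) / \<bar>real i - real j\<bar>"
        by (simp add: abs_divide)
    qed
    also have "\<dots> = (\<Prod>i\<in>J - {j}. real m + real i) / (\<Prod>i\<in>J - {j}. \<bar>real i - real j\<bar>)"
      by (rule prod_dividef)
    also have "\<dots> \<le> (2 * real m) ^ ?k / (fact ?k / 2 ^ ?k)"
    proof -
      have num: "(\<Prod>i\<in>J - {j}. real m + real i) \<le> (2 * real m) ^ card (J - {j})"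
        using assms m by (intro prod_le_power) auto
      have "(0::real) < fact ?k / 2 ^ ?k"
        by (intro divide_pos_pos fact_gt_zero zero_less_power) simp
      moreover have "(2 * real m) ^ card (J - {j}) = (2 * real m) ^ ?k"
        using j fin by (simp only: card_Diff_singleton)
      moreover have "0 \<le> (2 * real m) ^ ?k"
        by (intro zero_le_power) simp
      ultimately show ?thesis
        using frac_le[OF _ _ _ fact_le_prod_abs_diff[OF fin j]] num by metis
    qed
    also have "\<dots> = (4 * real m) ^ ?k / fact ?k"
    proof -
      have "4 * real m = 2 * real m * 2" by simp
      then have "(4 * real m) ^ ?k = (2 * real m) ^ ?k * 2 ^ ?k"
        by (simp only: power_mult_distrib)
      then show ?thesis by (simp only: divide_divide_eq_right)
    qed
    also have "\<dots> \<le> exp (4 * real m)"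
      using power_le_fact_mult_exp[of "4 * real m" ?k] by (simp add: divide_le_eq mult.commute)
    finally show ?thesis .
  qed
  then show ?thesis
    using sum_mono[of J "\<lambda>j. \<bar>\<Prod>i\<in>J - {j}. (1 + real i / real m) / ((1 + real i / real m) - (1 + real j / real m))\<bar>" "\<lambda>_. exp (4 * real m)"]
    by (simp only: sum_constant)
qed

text \<open>Replacing \<open>\<bar>v\<bar>\<close> by \<open>\<kappa> * \<bar>v\<bar>\<close> in the
  tail gains at least \<open>\<kappa> ^ N\<close> in each term, and the enlarged tail is below its
  full series. The free parameter \<open>\<kappa>\<close> later sets the rate of geometric decay in
  \<open>N\<close>.\<close>

lemma exp_taylor_remainder_le:
  fixes v \<kappa> :: real
  assumes "1 \<le> \<kappa>"
  shows "\<bar>exp v - (\<Sum>k<N. v ^ k / fact k)\<bar> \<le> exp (\<kappa> * \<bar>v\<bar>) / \<kappa> ^ N"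
proof -
  have "exp v = (\<Sum>k. v ^ (k + N) / fact (k + N)) + (\<Sum>k<N. v ^ k / fact k)"
    using suminf_split_initial_segment[OF summable_exp_generic[of v], of N]
    by (simp add: exp_def field_simps)
  then have "exp v - (\<Sum>k<N. v ^ k / fact k) = (\<Sum>k. v ^ (k + N) / fact (k + N))"
    by simp
  also have "\<bar>\<dots>\<bar> \<le> (\<Sum>k. (\<kappa> * \<bar>v\<bar>) ^ (k + N) / fact (k + N) / \<kappa> ^ N)"
  proof -
    have 1: "summable (\<lambda>k. (\<kappa> * \<bar>v\<bar>) ^ (k + N) / fact (k + N) / \<kappa> ^ N)"
      using summable_ignore_initial_segment[OF summable_exp_generic[of "\<kappa> * \<bar>v\<bar>"], of N]
      by (intro summable_divide) (simp add: field_simps)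
    have 2: "norm (v ^ (k + N) / fact (k + N)) \<le> (\<kappa> * \<bar>v\<bar>) ^ (k + N) / fact (k + N) / \<kappa> ^ N" for k
    proof -
      have "\<kappa> ^ N \<le> \<kappa> ^ (k + N)" using assms by (intro power_increasing) auto
      then have "\<kappa> ^ N * \<bar>v\<bar> ^ (k + N) \<le> \<kappa> ^ (k + N) * \<bar>v\<bar> ^ (k + N)" 
        by (intro mult_right_mono) auto
      then show ?thesis using assms by (simp add: field_simps power_mult_distrib power_abs)
    qed
    show ?thesis
      using norm_suminf_le[OF 2 1] by simp
  qed
  also have "\<dots> = (\<Sum>k. (\<kappa> * \<bar>v\<bar>) ^ (k + N) / fact (k + N)) / \<kappa> ^ N"
    using summable_ignore_initial_segment[OF summable_exp_generic[of "\<kappa> * \<bar>v\<bar>"], of N]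
    by (intro suminf_divide) (simp add: field_simps)
  also have "(\<Sum>k. (\<kappa> * \<bar>v\<bar>) ^ (k + N) / fact (k + N)) \<le> exp (\<kappa> * \<bar>v\<bar>)"
  proof -
    have "exp (\<kappa> * \<bar>v\<bar>) = (\<Sum>k. (\<kappa> * \<bar>v\<bar>) ^ (k + N) / fact (k + N)) + (\<Sum>k<N. (\<kappa> * \<bar>v\<bar>) ^ k / fact k)"
      using suminf_split_initial_segment[OF summable_exp_generic[of "\<kappa> * \<bar>v\<bar>"], of N]
      by (simp add: exp_def field_simps)
    moreover have "0 \<le> (\<Sum>k<N. (\<kappa> * \<bar>v\<bar>) ^ k / fact k)"
      using assms by (intro sum_nonneg) auto
    ultimately show ?thesis by simp
  qed
  finally show ?thesis using assms by (simp add: divide_right_mono)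
qed

section \<open>Gaussian integrals and the Mehler kernel\<close>

text \<open>The Gaussian is a product over the coordinates, and each factor is a multiple of the
  normal density of variance \<open>c / 2\<close>.\<close>

lemma nn_integral_exp_norm_square:
  fixes c :: real
  assumes "c > 0"
  shows "(\<integral>\<^sup>+z. exp (- (norm (z :: 'a::euclidean_space))\<^sup>2 / c) \<partial>lborel) = ennreal ((pi * c) powr (DIM('a) / 2))"
proof -
  have *: "exp (- u\<^sup>2 / c) = sqrt (pi * c) * normal_density 0 (sqrt (c / 2)) u" for u
    using assms by (simp add: normal_density_def)
  have 1: "(\<integral>\<^sup>+u. exp (- (u::real)\<^sup>2 / c) \<partial>lborel) = ennreal (sqrt (pi * c))"
    unfolding * using assms
    by (subst nn_integral_eq_integral) (auto simp: integral_normal_density normal_density_nonneg)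
  have "exp (- (norm z)\<^sup>2 / c) = (\<Prod>b\<in>Basis. exp (- (z \<bullet> b)\<^sup>2 / c))" for z :: 'a
    by (simp add: exp_sum [symmetric] norm_eq_sqrt_inner euclidean_inner [of z z]
          power2_eq_square [symmetric] sum_nonneg sum_negf sum_divide_distrib)
  then have "(\<integral>\<^sup>+z. exp (- (norm (z::'a))\<^sup>2 / c) \<partial>lborel) =
      (\<integral>\<^sup>+z. (\<Prod>b\<in>Basis. ennreal (exp (- ((z::'a) \<bullet> b)\<^sup>2 / c))) \<partial>lborel)"
    by (simp add: prod_ennreal)
  also have "\<dots> = (\<Prod>b\<in>(Basis::'a set). (\<integral>\<^sup>+u. exp (- (u::real)\<^sup>2 / c) \<partial>lborel))"
    by (subst nn_integral_lborel_prod) auto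
  also have "\<dots> = ennreal (sqrt (pi * c) ^ DIM('a))"
    unfolding 1 using assms by (simp add: ennreal_power)
  also have "sqrt (pi * c) ^ DIM('a) = (pi * c) powr (DIM('a) / 2)"
    using assms by (simp add: powr_half_sqrt [symmetric] powr_power)
  finally show ?thesis .
qed

lemma has_bochner_integral_exp_norm_square:
  fixes c :: real and m :: "'a::euclidean_space"
  assumes "c > 0"
  shows "has_bochner_integral lborel (\<lambda>z. exp (- (norm (z - m))\<^sup>2 / c)) ((pi * c) powr (DIM('a) / 2))"
proof -
  have "has_bochner_integral lborel (\<lambda>z::'a. exp (- (norm z)\<^sup>2 / c)) ((pi * c) powr (DIM('a) / 2))"
    using nn_integral_exp_norm_square[OF assms, where 'a='a]
    by (intro has_bochner_integral_nn_integral) auto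
  then have "has_bochner_integral (distr lborel borel ((+) (- m))) (\<lambda>z. exp (- (norm z)\<^sup>2 / c)) ((pi * c) powr (DIM('a) / 2))"
    by (simp add: lborel_distr_plus)
  moreover have "has_bochner_integral (distr lborel borel ((+) (- m))) (\<lambda>z. exp (- (norm z)\<^sup>2 / c)) ((pi * c) powr (DIM('a) / 2)) \<longleftrightarrow>
      has_bochner_integral lborel (\<lambda>z. exp (- (norm (- m + z))\<^sup>2 / c)) ((pi * c) powr (DIM('a) / 2))"
    by (simp add: has_bochner_integral_iff integrable_distr_eq integral_distr)
  ultimately show ?thesis by simp
qed

section \<open>The Mehler kernel as a transition density\<close>

lemma has_bochner_integral_mehler:
  assumes "t > 0"
  shows "has_bochner_integral lborel (mehler t (x :: real ^ 'd)) 1"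
proof -
  have a: "1 - exp (- 2 * t) > 0" using assms by simp
  have "mehler t x = (\<lambda>y. 1 / (pi powr (CARD('d) / 2) * (1 - exp (- 2 * t)) powr (CARD('d) / 2)) *
      exp (- (norm (y - exp (- t) *\<^sub>R x))\<^sup>2 / (1 - exp (- 2 * t))))"
    by (simp add: mehler_def fun_eq_iff)
  moreover have "1 / (pi powr (CARD('d) / 2) * (1 - exp (- 2 * t)) powr (CARD('d) / 2)) *
     (pi * (1 - exp (- 2 * t))) powr (CARD('d) / 2) = 1"
    using a by (simp add: powr_mult)
  ultimately show ?thesis
    using has_bochner_integral_mult_right[OF has_bochner_integral_exp_norm_square[OF a, of "exp (- t) *\<^sub>R x"],
       of "1 / (pi powr (CARD('d) / 2) * (1 - exp (- 2 * t)) powr (CARD('d) / 2))"]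
    by simp
qed

text \<open>Completing the square in \<open>y\<close>: the left-hand side is quadratic in
  \<open>y\<close> with leading coefficient \<open>1 / a + q\<^sup>2 / b = c / (a * b)\<close>. The
  vector divided by \<open>c\<close> is its minimiser, and the first term on the right is its
  minimum.\<close>

lemma mehler_exponent_completion:
  fixes x y z :: "'a::real_inner" and p q a b :: real
  assumes "0 < a" "0 < b" "c = a * q\<^sup>2 + b"
  shows "(norm (y - p *\<^sub>R x))\<^sup>2 / a + (norm (z - q *\<^sub>R y))\<^sup>2 / b =
    (norm (z - (q * p) *\<^sub>R x))\<^sup>2 / c + (norm (y - ((b * p) *\<^sub>R x + (a * q) *\<^sub>R z) /\<^sub>R c))\<^sup>2 / (a * b / c)"
proof -
  have c: "c > 0" using assms by (simp add: add_nonneg_pos)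
  \<comment> \<open>With names for the six inner products the claim becomes an identity between
    rational expressions in real numbers, checked over the common denominator
    \<open>a * b * c\<close>.\<close>
  define X where "X = x \<bullet> x" define Y where "Y = y \<bullet> y" define Z where "Z = z \<bullet> z"
  define XY where "XY = x \<bullet> y" define XZ where "XZ = x \<bullet> z" define YZ where "YZ = y \<bullet> z"
  have n1: "(norm (y - p *\<^sub>R x))\<^sup>2 = Y - 2 * p * XY + p\<^sup>2 * X"
    unfolding X_def Y_def XY_def power2_norm_eq_inner by (simp add: inner_diff inner_commute algebra_simps power2_eq_square)
  have n2: "(norm (z - q *\<^sub>R y))\<^sup>2 = Z - 2 * q * YZ + q\<^sup>2 * Y"
    unfolding Z_def Y_def YZ_def power2_norm_eq_inner by (simp add: inner_diff inner_commute algebra_simps power2_eq_square)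
  have n3: "(norm (z - (q * p) *\<^sub>R x))\<^sup>2 = Z - 2 * (q * p) * XZ + (q * p)\<^sup>2 * X"
    unfolding Z_def X_def XZ_def power2_norm_eq_inner by (simp add: inner_diff inner_commute algebra_simps power2_eq_square)
  have "y - ((b * p) *\<^sub>R x + (a * q) *\<^sub>R z) /\<^sub>R c = (c *\<^sub>R y - (b * p) *\<^sub>R x - (a * q) *\<^sub>R z) /\<^sub>R c"
    using c by (simp add: algebra_simps)
  then have "(norm (y - ((b * p) *\<^sub>R x + (a * q) *\<^sub>R z) /\<^sub>R c))\<^sup>2 = (norm (c *\<^sub>R y - (b * p) *\<^sub>R x - (a * q) *\<^sub>R z))\<^sup>2 / c\<^sup>2"
    by (simp add: power_mult_distrib power_inverse divide_inverse mult.commute)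
  also have "(norm (c *\<^sub>R y - (b * p) *\<^sub>R x - (a * q) *\<^sub>R z))\<^sup>2 =
     c\<^sup>2 * Y + (b * p)\<^sup>2 * X + (a * q)\<^sup>2 * Z - 2 * c * b * p * XY - 2 * c * a * q * YZ + 2 * b * p * a * q * XZ"
    unfolding X_def Y_def Z_def XY_def YZ_def XZ_def power2_norm_eq_inner by (simp add: inner_diff inner_commute algebra_simps power2_eq_square)
  finally have quot: "(norm (y - ((b * p) *\<^sub>R x + (a * q) *\<^sub>R z) /\<^sub>R c))\<^sup>2 / (a * b / c) = 
     (c\<^sup>2 * Y + (b * p)\<^sup>2 * X + (a * q)\<^sup>2 * Z - 2 * c * b * p * XY - 2 * c * a * q * YZ + 2 * b * p * a * q * XZ) / c\<^sup>2 / (a * b / c)"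
    by (simp only:)
  have "P / c\<^sup>2 / (a * b / c) = P / (a * b * c)" for P
    using c by (simp add: power2_eq_square)
  with quot have n4: "(norm (y - ((b * p) *\<^sub>R x + (a * q) *\<^sub>R z) /\<^sub>R c))\<^sup>2 / (a * b / c) =
     (c\<^sup>2 * Y + (b * p)\<^sup>2 * X + (a * q)\<^sup>2 * Z - 2 * c * b * p * XY - 2 * c * a * q * YZ + 2 * b * p * a * q * XZ) / (a * b * c)"
    by (simp only:)
  have "(Y - 2 * p * XY + p\<^sup>2 * X) / a + (Z - 2 * q * YZ + q\<^sup>2 * Y) / b =
     (c * b * (Y - 2 * p * XY + p\<^sup>2 * X) + c * a * (Z - 2 * q * YZ + q\<^sup>2 * Y)) / (a * b * c)"
    using c assms(1,2) by (simp add: field_simps)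
  moreover have "(Z - 2 * (q * p) * XZ + (q * p)\<^sup>2 * X) / c = a * b * (Z - 2 * (q * p) * XZ + (q * p)\<^sup>2 * X) / (a * b * c)"
    using c assms(1,2) by (simp add: field_simps)
  moreover have "c * b * (Y - 2 * p * XY + p\<^sup>2 * X) + c * a * (Z - 2 * q * YZ + q\<^sup>2 * Y) =
      a * b * (Z - 2 * (q * p) * XZ + (q * p)\<^sup>2 * X) + (c\<^sup>2 * Y + (b * p)\<^sup>2 * X + (a * q)\<^sup>2 * Z - 2 * c * b * p * XY - 2 * c * a * q * YZ + 2 * b * p * a * q * XZ)"
    unfolding assms(3) by algebra
  ultimately show ?thesis
    unfolding n1 n2 n3 n4 by (simp only: add_divide_distrib)
qed

text \<open>Completing the square leaves a Gaussian in \<open>y\<close> times a factor independent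
  of \<open>y\<close>. With \<open>p = exp (- t)\<close> and \<open>q = exp (- s)\<close> the
  parameters combine to \<open>c = 1 - exp (- 2 * (s + t))\<close>.\<close>

lemma chapman_kolmogorov_mehler:
  assumes "s > 0" "t > 0"
  shows "has_bochner_integral lborel (\<lambda>y. mehler t x y * mehler s y z) (mehler (s + t) x (z :: real ^ 'd))"
proof -
  let ?d = "CARD('d) / 2"
  define a where "a = 1 - exp (- 2 * t)"
  define b where "b = 1 - exp (- 2 * s)"
  define c where "c = 1 - exp (- 2 * (s + t))"
  have pos: "a > 0" "b > 0" "c > 0" using assms by (auto simp: a_def b_def c_def)
  have c: "c = a * (exp (- s))\<^sup>2 + b"
    unfolding a_def b_def c_def by (simp add: algebra_simps flip: exp_double exp_add)
  define m where "m = ((b * exp (- t)) *\<^sub>R x + (a * exp (- s)) *\<^sub>R z) /\<^sub>R c"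
  define k where "k = 1 / (pi powr ?d * a powr ?d) * (1 / (pi powr ?d * b powr ?d)) * exp (- (norm (z - exp (- (s + t)) *\<^sub>R x))\<^sup>2 / c)"
  have eq: "mehler t x y * mehler s y z = k * exp (- (norm (y - m))\<^sup>2 / (a * b / c))" for y
  proof -
    have "exp (- (norm (y - exp (- t) *\<^sub>R x))\<^sup>2 / a) * exp (- (norm (z - exp (- s) *\<^sub>R y))\<^sup>2 / b)
       = exp (- ((norm (y - exp (- t) *\<^sub>R x))\<^sup>2 / a + (norm (z - exp (- s) *\<^sub>R y))\<^sup>2 / b))"
      by (simp flip: exp_add)
    also have "\<dots> = exp (- ((norm (z - (exp (- s) * exp (- t)) *\<^sub>R x))\<^sup>2 / c + (norm (y - m))\<^sup>2 / (a * b / c)))"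
      unfolding m_def by (subst mehler_exponent_completion[OF pos(1,2) c]) simp
    also have "\<dots> = exp (- (norm (z - exp (- (s + t)) *\<^sub>R x))\<^sup>2 / c) * exp (- (norm (y - m))\<^sup>2 / (a * b / c))"
      by (simp flip: exp_add)
    finally have "1 / (pi powr ?d * a powr ?d) * (1 / (pi powr ?d * b powr ?d)) *
        (exp (- (norm (y - exp (- t) *\<^sub>R x))\<^sup>2 / a) * exp (- (norm (z - exp (- s) *\<^sub>R y))\<^sup>2 / b)) =
        1 / (pi powr ?d * a powr ?d) * (1 / (pi powr ?d * b powr ?d)) *
        (exp (- (norm (z - exp (- (s + t)) *\<^sub>R x))\<^sup>2 / c) * exp (- (norm (y - m))\<^sup>2 / (a * b / c)))"
      by (simp only:)
    then show ?thesis
      unfolding mehler_def k_def a_def[symmetric] b_def[symmetric] by (simp only: mult_ac)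
  qed
  have "k * (pi * (a * b / c)) powr (DIM(real ^ 'd) / 2) = mehler (s + t) x z"
    unfolding k_def mehler_def c_def [symmetric] using pos by (simp add: powr_mult powr_divide)
  moreover have "has_bochner_integral lborel (\<lambda>y. k * exp (- (norm (y - m))\<^sup>2 / (a * b / c))) (k * (pi * (a * b / c)) powr (DIM(real ^ 'd) / 2))"
    using pos by (intro has_bochner_integral_mult_right has_bochner_integral_exp_norm_square) auto
  ultimately show ?thesis
    unfolding eq by simp
qed

section \<open>Contractivity and the semigroup law\<close>

text \<open>The kernel \<open>k\<close> is left general because the bound serves both for the Mehler
  kernel and for the signed error kernel of the extrapolation.\<close>

lemma integrable_scaleR_bcontfun:
  fixes f :: "(real ^ 'd) \<Rightarrow>\<^sub>C 'k::{banach, second_countable_topology}"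
  assumes "integrable lborel k"
  shows "integrable lborel (\<lambda>y. k y *\<^sub>R apply_bcontfun f y)"
    and "norm (\<integral>y. k y *\<^sub>R apply_bcontfun f y \<partial>lborel) \<le> (\<integral>y. \<bar>k y\<bar> \<partial>lborel) * norm f"
proof -
  have [measurable]: "apply_bcontfun f \<in> borel_measurable borel"
    by (intro borel_measurable_continuous_onI continuous_on_apply_bcontfun)
  have [measurable]: "k \<in> borel_measurable lborel"
    using assms by measurable
  have int: "integrable lborel (\<lambda>y. \<bar>k y\<bar> * norm f)"
    using assms by auto
  have bound: "norm (k y *\<^sub>R apply_bcontfun f y) \<le> \<bar>k y\<bar> * norm f" for y
    using norm_bounded[of f y] by (simp add: mult_left_mono)
  show 1: "integrable lborel (\<lambda>y. k y *\<^sub>R apply_bcontfun f y)"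
    by (rule Bochner_Integration.integrable_bound [OF int]) (use bound in \<open>auto simp: abs_mult\<close>)
  have "norm (\<integral>y. k y *\<^sub>R apply_bcontfun f y \<partial>lborel) \<le> (\<integral>y. \<bar>k y\<bar> * norm f \<partial>lborel)"
    by (rule Bochner_Integration.integral_norm_bound_integral [OF 1 int bound])
  then show "norm (\<integral>y. k y *\<^sub>R apply_bcontfun f y \<partial>lborel) \<le> (\<integral>y. \<bar>k y\<bar> \<partial>lborel) * norm f"
    by simp
qed

text \<open>The kernel is nonnegative with total mass 1; for nonpositive times the operator is the
  identity by definition.\<close>

lemma norm_ou_semigroup_le:
  fixes f :: "(real ^ 'd) \<Rightarrow>\<^sub>C 'k::{banach, second_countable_topology}"
  shows "norm (ou_semigroup t f) \<le> norm f"
proof (cases "t > 0")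
  case True
  show ?thesis
  proof (rule norm_bound)
    fix x :: "real ^ 'd"
    have "integrable lborel (mehler t x)" "(\<integral>y. mehler t x y \<partial>lborel) = 1"
      using has_bochner_integral_mehler[OF True, of x] by (auto simp: has_bochner_integral_iff)
    then show "norm (apply_bcontfun (ou_semigroup t f) x) \<le> norm f"
      using integrable_scaleR_bcontfun(2)[of "mehler t x" f] True
      by (simp add: apply_ou_semigroup mehler_nonneg)
  qed
qed (simp add: ou_semigroup_def)

text \<open>Fubini's theorem exchanges the two integrations, after which the Chapman-Kolmogorov
  identity merges the kernels.\<close>

lemma ou_semigroup_add:
  fixes f :: "(real ^ 'd) \<Rightarrow>\<^sub>C 'k::{banach, second_countable_topology}"
  assumes "s > 0" "t > 0"
  shows "ou_semigroup (s + t) f = ou_semigroup t (ou_semigroup s f)"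
proof (rule bcontfun_eqI)
  fix x :: "real ^ 'd"
  have [measurable]: "apply_bcontfun f \<in> borel_measurable borel"
    by (intro borel_measurable_continuous_onI continuous_on_apply_bcontfun)
  let ?F = "\<lambda>y z. (mehler t x y * mehler s y z) *\<^sub>R apply_bcontfun f z"
  have int: "integrable lborel (mehler u y)" and mass: "(\<integral>z. mehler u y z \<partial>lborel) = 1"
    if "u > 0" for u and y :: "real ^ 'd"
    using has_bochner_integral_mehler[OF that, of y] by (auto simp: has_bochner_integral_iff)
  have inner: "integrable lborel (?F y)" for y
    using assms by (intro integrable_scaleR_bcontfun integrable_mult_right int)
  have meas: "(\<lambda>(y, z). ?F y z) \<in> borel_measurable (lborel \<Otimes>\<^sub>M lborel)"
    unfolding mehler_def by measurable
  \<comment> \<open>Absolute integrability: integrating out \<open>z\<close> first leaves at most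
    \<open>mehler t x y * norm f\<close>, since \<open>mehler s y\<close> has mass 1.\<close>
  have "integrable (lborel \<Otimes>\<^sub>M lborel) (\<lambda>(y, z). ?F y z)"
  proof (rule lborel_pair.Fubini_integrable [OF meas])
    show "integrable lborel (\<lambda>y. \<integral>z. norm (case (y, z) of (y, z) \<Rightarrow> ?F y z) \<partial>lborel)"
    proof (rule Bochner_Integration.integrable_bound)
      show "integrable lborel (\<lambda>y. mehler t x y * norm f)"
        using int[OF assms(2)] by simp
      show "(\<lambda>y. \<integral>z. norm (case (y, z) of (y, z) \<Rightarrow> ?F y z) \<partial>lborel) \<in> borel_measurable lborel"
        using meas by measurable
      have "(\<integral>z. norm (?F y z) \<partial>lborel) \<le> mehler t x y * norm f" for y
      proof -
        have "(\<integral>z. norm (?F y z) \<partial>lborel) \<le> (\<integral>z. mehler t x y * mehler s y z * norm f \<partial>lborel)"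
        proof (rule integral_mono)
          show "integrable lborel (\<lambda>z. norm (?F y z))"
            using inner[of y] by (rule integrable_norm)
          show "integrable lborel (\<lambda>z. mehler t x y * mehler s y z * norm f)"
            using int[OF assms(1)] by simp
          show "norm (?F y z) \<le> mehler t x y * mehler s y z * norm f" for z
            using norm_bounded[of f z] by (simp add: mehler_nonneg mult_left_mono)
        qed
        also have "\<dots> = mehler t x y * norm f"
          using mass[OF assms(1)] by simp
        finally show ?thesis .
      qed
      then show "AE y in lborel. norm (\<integral>z. norm (case (y, z) of (y, z) \<Rightarrow> ?F y z) \<partial>lborel) \<le> norm (mehler t x y * norm f)"
        by (intro AE_I2) (auto simp: mehler_nonneg intro: order_trans[OF _ abs_ge_self])
    qed
    show "AE y in lborel. integrable lborel (\<lambda>z. case (y, z) of (y, z) \<Rightarrow> ?F y z)"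
      using inner by simp
  qed
  then have "(\<integral>z. (\<integral>y. ?F y z \<partial>lborel) \<partial>lborel) = (\<integral>y. (\<integral>z. ?F y z \<partial>lborel) \<partial>lborel)"
    by (rule lborel_pair.Fubini_integral)
  moreover have "(\<integral>y. ?F y z \<partial>lborel) = mehler (s + t) x z *\<^sub>R apply_bcontfun f z" for z
    using chapman_kolmogorov_mehler[OF assms, of x z]
    by (simp add: has_bochner_integral_iff integral_scaleR_left)
  moreover have "(\<integral>z. ?F y z \<partial>lborel) = mehler t x y *\<^sub>R apply_bcontfun (ou_semigroup s f) y" for y
    using assms by (simp add: apply_ou_semigroup flip: scaleR_scaleR integral_scaleR_right)
  ultimately show "apply_bcontfun (ou_semigroup (s + t) f) x = apply_bcontfun (ou_semigroup t (ou_semigroup s f)) x"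
    using assms by (simp add: apply_ou_semigroup)
qed

section \<open>Interpolation nodes in thick sets\<close>

text \<open>\<open>B\<close> is the part of \<open>\<Omega>\<close> in the translated box, moved
  back to the origin and shrunk by the factor \<open>s\<close>. As \<open>s \<ge> 1\<close>, it
  stays in the box; as \<open>s \<le> 2\<close>, it keeps at least the fraction
  \<open>1 / 2 ^ d\<close> of the measure. So these sets share one box for all
  \<open>s\<close>.\<close>

lemma thick_scaled_preimage:
  fixes \<Omega> :: "(real ^ 'd) set"
  assumes \<Omega>: "\<Omega> \<in> sets lebesgue" and L: "\<And>j. 0 < L $ j" and s: "1 \<le> s" "s \<le> 2" and "0 < \<rho>"
    and dens: "measure lebesgue (\<Omega> \<inter> (+) x ` box 0 L) \<ge> \<rho> * measure lebesgue (box 0 L)"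
  defines "B \<equiv> {v. x + s *\<^sub>R v \<in> \<Omega> \<inter> (+) x ` box 0 L}"
  shows "B \<in> lmeasurable" "B \<subseteq> box 0 L" "measure lebesgue B \<ge> \<rho> / 2 ^ CARD('d) * measure lebesgue (box 0 L)"
proof -
  let ?A = "\<Omega> \<inter> (+) x ` box 0 L"
  show sub: "B \<subseteq> box 0 L"
  proof
    fix v assume "v \<in> B"
    then have "s *\<^sub>R v \<in> box 0 L" by (auto simp: B_def)
    then have v: "0 < s * v $ j" "s * v $ j < L $ j" for j
      by (auto simp: mem_box_cart)
    have "0 < v $ j \<and> v $ j < L $ j" for j
    proof -
      have "0 < v $ j" using v(1)[of j] s by (simp add: zero_less_mult_iff)
      moreover from this have "1 * v $ j \<le> s * v $ j" using s by (intro mult_right_mono) auto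
      ultimately show ?thesis using v(2)[of j] by linarith
    qed
    then show "v \<in> box 0 L" by (simp add: mem_box_cart)
  qed
  have "(+) x ` box 0 L \<in> sets lebesgue"
    using borel_open[OF open_translation[OF open_box]] by (intro sets_completionI_sets) simp
  then have A: "?A \<in> sets lebesgue" using \<Omega> by blast
  have "(\<lambda>v. x + (\<Sum>j\<in>Basis. (s * (v \<bullet> j)) *\<^sub>R j)) \<in> lebesgue \<rightarrow>\<^sub>M lebesgue"
    using lebesgue_affine_measurable[where c = "\<lambda>_. s" and t = x] s by simp
  moreover have "(\<Sum>j\<in>Basis. (s * (v \<bullet> j)) *\<^sub>R j) = s *\<^sub>R v" for v :: "real ^ 'd"
    by (simp add: euclidean_representation flip: scaleR_scaleR scaleR_sum_right)
  ultimately have "(\<lambda>v. x + s *\<^sub>R v) \<in> lebesgue \<rightarrow>\<^sub>M lebesgue" by simp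
  from measurable_sets[OF this A] have "B \<in> sets lebesgue"
    by (simp add: B_def vimage_def)
  then show "B \<in> lmeasurable"
    using sub bounded_subset[OF bounded_box] by (intro bounded_set_imp_lmeasurable)
  have "y \<in> (\<lambda>v. s *\<^sub>R v + x) ` B" if "y \<in> ?A" for y
    using that s by (intro image_eqI[of _ _ "(1 / s) *\<^sub>R (y - x)"]) (auto simp: B_def)
  then have "(\<lambda>v. s *\<^sub>R v + x) ` B = ?A"
    by (auto simp: B_def add.commute)
  then have "measure lebesgue ?A = s ^ CARD('d) * measure lebesgue B"
    using measure_lebesgue_affine[of s x B] s by simp
  also have "\<dots> \<le> 2 ^ CARD('d) * measure lebesgue B"
    using s by (intro mult_right_mono power_mono) auto
  finally show "measure lebesgue B \<ge> \<rho> / 2 ^ CARD('d) * measure lebesgue (box 0 L)"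
    using dens by (simp add: field_simps)
qed

text \<open>Averaging: the integral over \<open>Q\<close> of the number of sets containing
  \<open>v\<close> is at least \<open>\<rho> * m * measure M Q\<close>, which exceeds
  \<open>n * measure M Q\<close>, so this number cannot stay below \<open>n\<close>.\<close>

lemma exists_point_in_many_sets:
  assumes Q: "Q \<in> fmeasurable M" "measure M Q > 0"
    and B: "\<And>i. i < m \<Longrightarrow> B i \<in> fmeasurable M" "\<And>i. i < m \<Longrightarrow> B i \<subseteq> Q"
      "\<And>i. i < m \<Longrightarrow> \<rho> * measure M Q \<le> measure M (B i)"
    and n: "real n < \<rho> * real m"
  shows "\<exists>v. n \<le> card {i. i < m \<and> v \<in> B i}"
proof (rule ccontr)
  assume "\<not> ?thesis"
  \<comment> \<open>The weak inequality suffices here: the contradiction draws its strictness from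
    \<open>n < \<rho> * m\<close>.\<close>
  then have less: "card {i. i < m \<and> v \<in> B i} \<le> n" for v
    by (meson nat_le_linear)
  have "real n * measure M Q < \<rho> * real m * measure M Q"
    using n Q by (intro mult_strict_right_mono) auto
  also have "\<dots> = (\<Sum>i<m. \<rho> * measure M Q)"
    by simp
  also have "\<dots> \<le> (\<Sum>i<m. measure M (B i))"
    using B by (intro sum_mono) auto
  also have "\<dots> = (\<Sum>i<m. \<integral>v. indicator (B i) v \<partial>M)"
    using B by (intro sum.cong refl) (auto simp: fmeasurable_def Int_absorb2 sets.sets_into_space)
  also have "\<dots> = (\<integral>v. (\<Sum>i<m. indicator (B i) v) \<partial>M)"
    using B(1) by (intro Bochner_Integration.integral_sum [symmetric]) (auto simp: fmeasurable_def)
  also have "\<dots> \<le> (\<integral>v. real n * indicator Q v \<partial>M)"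
  proof (rule integral_mono)
    show "integrable M (\<lambda>v. \<Sum>i<m. indicator (B i) v :: real)"
      using B(1) by (intro Bochner_Integration.integrable_sum) (auto simp: fmeasurable_def)
    show "integrable M (\<lambda>v. real n * indicator Q v)"
      using Q by (auto simp: fmeasurable_def)
    fix v
    have "(\<Sum>i<m. indicator (B i) v :: real) = real (card {i. i < m \<and> v \<in> B i})"
      by (simp add: indicator_def sum.If_cases lessThan_def Int_def)
    also have "\<dots> \<le> real n * indicator Q v"
    proof (cases "v \<in> Q")
      case False
      then have empty: "{i. i < m \<and> v \<in> B i} = {}" using B(2) by auto
      show ?thesis unfolding empty by simp
    qed (use less in auto)
    finally show "(\<Sum>i<m. indicator (B i) v :: real) \<le> real n * indicator Q v" .
  qed
  also have "\<dots> = real n * measure M Q"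
    using Q by (simp add: fmeasurable_def Int_absorb2 sets.sets_into_space)
  finally show False by simp
qed

text \<open>For each factor \<open>1 + i / m\<close> the admissible directions \<open>v\<close> fill
  a fixed proportion of the same box, so averaging yields one direction that serves \<open>n\<close>
  of the factors. The bounds are uniform in \<open>x\<close>, and \<open>m\<close> grows only
  linearly in \<open>n\<close>.\<close>

lemma thick_nodes:
  fixes \<Omega> :: "(real ^ 'd) set"
  assumes "thick \<Omega>"
  obtains b K where "0 \<le> b" "0 \<le> K"
    "\<And>x n. n \<ge> 1 \<Longrightarrow> \<exists>v m J. norm v \<le> b \<and> J \<subseteq> {..<m} \<and> card J = n \<and> real m \<le> K * real n \<and>
       (\<forall>i\<in>J. x + (1 + real i / real m) *\<^sub>R v \<in> \<Omega>)"
proof -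
  obtain L \<rho> where \<Omega>: "\<Omega> \<in> sets lebesgue" and L: "\<And>j. 0 < L $ j" and \<rho>: "0 < \<rho>" "\<rho> \<le> 1"
    and dens: "\<And>x. measure lebesgue (\<Omega> \<inter> (+) x ` box 0 L) \<ge> \<rho> * measure lebesgue (box 0 L)"
    using assms unfolding thick_def by blast
  have Qpos: "measure lebesgue (box 0 L) > 0"
    using L by (auto simp: measure_lborel_box_eq Basis_vec_def inner_axis
        intro!: prod_pos less_imp_le)
  obtain b where b: "\<And>v. v \<in> box 0 L \<Longrightarrow> norm v \<le> b" "0 < b"
    using bounded_box[of 0 L] unfolding bounded_pos by auto
  \<comment> \<open>The proportion of the box that survives shrinking by a factor of at most 2 in
    every coordinate.\<close>
  define \<sigma> where "\<sigma> = \<rho> / 2 ^ CARD('d)"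
  have "\<rho> / 2 ^ CARD('d) \<le> 1 / 1"
    using \<rho> by (intro frac_le) auto
  then have \<sigma>: "0 < \<sigma>" "\<sigma> \<le> 1" using \<rho> by (auto simp: \<sigma>_def)
  show thesis
  proof (rule that[of b "2 / \<sigma>"])
    fix x :: "real ^ 'd" and n :: nat assume n: "n \<ge> 1"
    \<comment> \<open>Adding 1 to the floor gives the strict inequality
      \<open>n < \<sigma> * m\<close>; as \<open>n / \<sigma> \<ge> 1\<close>, it costs at most a
      factor 2.\<close>
    define m where "m = nat \<lfloor>real n / \<sigma>\<rfloor> + 1"
    have "real n / 1 \<le> real n / \<sigma>"
      using \<sigma> by (intro divide_left_mono) auto
    then have "1 \<le> real n / \<sigma>" using n by simp
    then have m: "real n / \<sigma> < real m" "real m \<le> 2 / \<sigma> * real n"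
      unfolding m_def by (auto simp: of_nat_nat) linarith+
    let ?s = "\<lambda>i. 1 + real i / real m"
    define B where "B i = {v. x + ?s i *\<^sub>R v \<in> \<Omega> \<inter> (+) x ` box 0 L}" for i
    have s: "1 \<le> ?s i" "?s i \<le> 2" if "i < m" for i
      using that by auto
    have "\<exists>v. n \<le> card {i. i < m \<and> v \<in> B i}"
    proof (rule exists_point_in_many_sets[of "box 0 L" lebesgue m B \<sigma>])
      show "real n < \<sigma> * real m" using m(1) \<sigma> by (simp add: field_simps)
      show "box 0 L \<in> lmeasurable" by simp
    qed (use Qpos thick_scaled_preimage[OF \<Omega> L s \<rho>(1) dens] in \<open>auto simp: B_def \<sigma>_def\<close>)
    then obtain v where "n \<le> card {i. i < m \<and> v \<in> B i}" by blast
    then obtain J where J: "J \<subseteq> {i. i < m \<and> v \<in> B i}" "card J = n"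
      by (meson obtain_subset_with_card_n)
    \<comment> \<open>Membership in some \<open>B i\<close> puts \<open>v\<close> into the box and
      thereby bounds its norm; \<open>n \<ge> 1\<close> provides such an index.\<close>
    then obtain i where "i < m" "v \<in> B i" using n by (metis (no_types, lifting) card.empty ex_in_conv mem_Collect_eq not_one_le_zero subsetD)
    then have "v \<in> box 0 L"
      using thick_scaled_preimage(2)[OF \<Omega> L s \<rho>(1) dens, of i] by (auto simp: B_def)
    then show "\<exists>v m J. norm v \<le> b \<and> J \<subseteq> {..<m} \<and> card J = n \<and> real m \<le> 2 / \<sigma> * real n \<and>
       (\<forall>i\<in>J. x + (1 + real i / real m) *\<^sub>R v \<in> \<Omega>)"
      using J m(2) b(1) by (intro exI[of _ v] exI[of _ m] exI[of _ J]) (auto simp: B_def)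
  qed (use b \<sigma> in auto)
qed

section \<open>The interpolation inequality\<close>

text \<open>As a function of \<open>w\<close>, the kernel at \<open>x + w *\<^sub>R v\<close> is the
  kernel at \<open>x\<close> times the exponential of a quadratic polynomial \<open>V\<close> with
  \<open>V 0 = 0\<close>. Extrapolation is exact on a Taylor polynomial of the exponential composed
  with \<open>V\<close>, which leaves the remainder. Its growth in \<open>y\<close> is absorbed by
  half of the Gaussian decay, whence the \<open>2 * a\<close>.\<close>

lemma mehler_interpolation_error:
  fixes x v y :: "real ^ 'd" and s :: "'a \<Rightarrow> real"
  assumes "t > 0" "finite J" "inj_on s J" "card J = 2 * N" "N \<ge> 1" "norm v \<le> b" "\<kappa> \<ge> 1"
    and s: "\<And>j. j \<in> J \<Longrightarrow> 0 \<le> s j \<and> s j \<le> 2"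
  defines "a \<equiv> 1 - exp (- 2 * t)" and "c \<equiv> \<lambda>j. \<Prod>i\<in>J - {j}. s i / (s i - s j)"
  shows "\<bar>mehler t x y - (\<Sum>j\<in>J. c j * mehler t (x + s j *\<^sub>R v) y)\<bar> \<le>
    (\<Sum>j\<in>J. \<bar>c j\<bar>) / \<kappa> ^ N * exp (12 * \<kappa>\<^sup>2 * b\<^sup>2 / a) *
    (1 / (pi powr (CARD('d) / 2) * a powr (CARD('d) / 2)) * exp (- (norm (y - exp (- t) *\<^sub>R x))\<^sup>2 / (2 * a)))"
proof -
  have a: "a > 0" using assms(1) by (simp add: a_def)
  have b: "b \<ge> 0" using assms(6) norm_ge_zero order_trans by blast
  define Z where "Z = 1 / (pi powr (CARD('d) / 2) * a powr (CARD('d) / 2))"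
  have Z: "Z \<ge> 0" by (simp add: Z_def)
  define p where "p = y - exp (- t) *\<^sub>R x"
  define u where "u = exp (- t) *\<^sub>R v"
  have u: "norm u \<le> b"
  proof -
    have "norm u \<le> 1 * norm v" unfolding u_def norm_scaleR using assms(1) by (intro mult_right_mono) auto
    then show ?thesis using assms(6) by simp
  qed
  \<comment> \<open>The part depending on \<open>w\<close> of the exponent
    \<open>- (norm (p - w *\<^sub>R u))\<^sup>2 / a\<close>.\<close>
  define V where "V = [:0, 2 * (p \<bullet> u) / a, - (norm u)\<^sup>2 / a:]"
  have mehler_eq: "mehler t (x + w *\<^sub>R v) y = Z * exp (- (norm p)\<^sup>2 / a) * exp (poly V w)" for w
  proof -
    have "y - exp (- t) *\<^sub>R (x + w *\<^sub>R v) = p - w *\<^sub>R u"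
      by (simp add: p_def u_def algebra_simps)
    moreover have "(norm (p - w *\<^sub>R u))\<^sup>2 = (norm p)\<^sup>2 - 2 * w * (p \<bullet> u) + w\<^sup>2 * (norm u)\<^sup>2"
      unfolding power2_norm_eq_inner by (simp add: inner_diff inner_commute algebra_simps power2_eq_square)
    moreover have "- ((norm p)\<^sup>2 - 2 * w * (p \<bullet> u) + w\<^sup>2 * (norm u)\<^sup>2) / a = - (norm p)\<^sup>2 / a + poly V w"
      using a by (simp add: V_def field_simps power2_eq_square)
    ultimately show ?thesis
      unfolding mehler_def a_def [symmetric] Z_def [symmetric] by (simp only: exp_add mult.assoc)
  qed
  \<comment> \<open>\<open>q\<close> has degree below \<open>2 * N\<close>, so interpolation reproduces it; only the Taylor remainder is lost.\<close>
  define q where "q = (\<Sum>k<N. smult (1 / fact k) (V ^ k))"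
  have poly_q: "poly q w = (\<Sum>k<N. poly V w ^ k / fact k)" for w
    by (simp add: q_def poly_sum)
  have "poly q 0 = (\<Sum>k<N. if k = 0 then 1 else 0)"
    unfolding poly_q by (intro sum.cong) (auto simp: V_def)
  then have q0: "poly q 0 = 1"
    using assms(5) by simp
  have "degree V \<le> 2" by (simp add: V_def)
  then have "degree (smult (1 / fact k) (V ^ k)) \<le> 2 * (N - 1)" if "k < N" for k
    using that by (intro order_trans [OF degree_smult_le] order_trans [OF degree_power_le]) (simp add: mult_mono)
  then have "degree q \<le> 2 * (N - 1)"
    unfolding q_def by (intro degree_sum_le) auto
  then have deg: "degree q < card J"
    using assms(4,5) by simp
  have lag: "(\<Sum>j\<in>J. c j * poly q (s j)) = 1"
    using lagrange_functional[OF assms(2,3) deg] q0 by (simp add: c_def)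
  \<comment> \<open>A remainder bound valid at all nodes: there \<open>\<bar>V\<bar>\<close> is at
    most \<open>(4 * b * norm p + 4 * b\<^sup>2) / a\<close>, since \<open>s j \<le> 2\<close> and
    \<open>norm u \<le> b\<close>.\<close>
  define R where "R = exp (\<kappa> * ((4 * b * norm p + 4 * b\<^sup>2) / a)) / \<kappa> ^ N"
  have rem: "\<bar>exp (poly V (s j)) - poly q (s j)\<bar> \<le> R" if "j \<in> J" for j
  proof -
    have "\<bar>poly V (s j)\<bar> = \<bar>s j * (2 * (p \<bullet> u)) - (s j)\<^sup>2 * (norm u)\<^sup>2\<bar> / a"
      using a by (simp add: V_def field_simps power2_eq_square abs_divide flip: diff_divide_distrib)
    also have "\<dots> \<le> (4 * b * norm p + 4 * b\<^sup>2) / a"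
    proof (intro divide_right_mono)
      have pu: "\<bar>p \<bullet> u\<bar> \<le> norm p * b"
        using Cauchy_Schwarz_ineq2[of p u] mult_left_mono[OF u, of "norm p"] by simp
      have "\<bar>s j * (2 * (p \<bullet> u))\<bar> \<le> 2 * (2 * (norm p * b))"
        unfolding abs_mult using s[OF that] pu by (intro mult_mono) auto
      moreover have "(s j)\<^sup>2 * (norm u)\<^sup>2 \<le> 2\<^sup>2 * b\<^sup>2"
        using s[OF that] u b by (intro mult_mono power_mono) auto
      moreover have "0 \<le> (s j)\<^sup>2 * (norm u)\<^sup>2" by simp
      ultimately have "\<bar>s j * (2 * (p \<bullet> u)) - (s j)\<^sup>2 * (norm u)\<^sup>2\<bar> \<le> 2 * (2 * (norm p * b)) + 2\<^sup>2 * b\<^sup>2"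
        by linarith
      then show "\<bar>s j * (2 * (p \<bullet> u)) - (s j)\<^sup>2 * (norm u)\<^sup>2\<bar> \<le> 4 * b * norm p + 4 * b\<^sup>2"
        by (simp add: mult_ac)
    qed (use a in simp)
    finally have "exp (\<kappa> * \<bar>poly V (s j)\<bar>) / \<kappa> ^ N \<le> R"
      unfolding R_def using assms(7) by (intro divide_right_mono) (simp_all del: times_divide_eq_right add: mult_left_mono)
    then show ?thesis
      using exp_taylor_remainder_le[OF assms(7), of "poly V (s j)" N] unfolding poly_q by linarith
  qed
  have "\<bar>1 - (\<Sum>j\<in>J. c j * exp (poly V (s j)))\<bar> = \<bar>\<Sum>j\<in>J. c j * (exp (poly V (s j)) - poly q (s j))\<bar>"
    unfolding lag [symmetric] by (simp add: right_diff_distrib sum_subtractf abs_minus_commute)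
  also have "\<dots> \<le> (\<Sum>j\<in>J. \<bar>c j\<bar> * \<bar>exp (poly V (s j)) - poly q (s j)\<bar>)"
    using sum_abs[of "\<lambda>j. c j * (exp (poly V (s j)) - poly q (s j))" J] by (simp add: abs_mult)
  also have "\<dots> \<le> (\<Sum>j\<in>J. \<bar>c j\<bar> * R)"
    using rem by (intro sum_mono mult_left_mono) auto
  finally have main: "\<bar>1 - (\<Sum>j\<in>J. c j * exp (poly V (s j)))\<bar> \<le> (\<Sum>j\<in>J. \<bar>c j\<bar>) * R"
    by (simp add: sum_distrib_right)
  have "mehler t x y = Z * exp (- (norm p)\<^sup>2 / a)"
    using mehler_eq[of 0] by (simp add: V_def)
  then have "mehler t x y - (\<Sum>j\<in>J. c j * mehler t (x + s j *\<^sub>R v) y) =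
      Z * exp (- (norm p)\<^sup>2 / a) * (1 - (\<Sum>j\<in>J. c j * exp (poly V (s j))))"
    unfolding mehler_eq by (simp add: right_diff_distrib sum_distrib_left mult_ac)
  then have "\<bar>mehler t x y - (\<Sum>j\<in>J. c j * mehler t (x + s j *\<^sub>R v) y)\<bar> \<le>
      Z * exp (- (norm p)\<^sup>2 / a) * ((\<Sum>j\<in>J. \<bar>c j\<bar>) * R)"
    using main Z by (simp add: abs_mult mult_left_mono)
  also have "\<dots> = (\<Sum>j\<in>J. \<bar>c j\<bar>) / \<kappa> ^ N * Z *
      exp (- (norm p)\<^sup>2 / a + \<kappa> * ((4 * b * norm p + 4 * b\<^sup>2) / a))"
    unfolding R_def exp_add by (simp only: times_divide_eq_left times_divide_eq_right mult_ac)
  also have "\<dots> \<le> (\<Sum>j\<in>J. \<bar>c j\<bar>) / \<kappa> ^ N * Z *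
      exp (12 * \<kappa>\<^sup>2 * b\<^sup>2 / a + - (norm p)\<^sup>2 / (2 * a))"
  proof (intro mult_left_mono)
    \<comment> \<open>Young's inequality: \<open>4 * \<kappa> * b * norm p \<le> (norm p)\<^sup>2 /
      2 + 8 * \<kappa>\<^sup>2 * b\<^sup>2\<close>. Together with \<open>4 * \<kappa> * b\<^sup>2
      \<le> 4 * \<kappa>\<^sup>2 * b\<^sup>2\<close> this produces the constant 12.\<close>
    have "0 \<le> (norm p - 4 * \<kappa> * b)\<^sup>2" by simp
    then have "2 * (4 * \<kappa> * b * norm p) \<le> (norm p)\<^sup>2 + 16 * \<kappa>\<^sup>2 * b\<^sup>2"
      by (simp add: power2_eq_square algebra_simps)
    moreover have "\<kappa> * (4 * b\<^sup>2) \<le> \<kappa>\<^sup>2 * (4 * b\<^sup>2)"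
      using assms(7) by (intro mult_right_mono) (auto simp: power2_eq_square)
    ultimately have "- 2 * (norm p)\<^sup>2 + 2 * (\<kappa> * (4 * b * norm p + 4 * b\<^sup>2)) \<le> 24 * \<kappa>\<^sup>2 * b\<^sup>2 - (norm p)\<^sup>2"
      by (simp add: algebra_simps)
    then have "(- 2 * (norm p)\<^sup>2 + 2 * (\<kappa> * (4 * b * norm p + 4 * b\<^sup>2))) / (2 * a) \<le> (24 * \<kappa>\<^sup>2 * b\<^sup>2 - (norm p)\<^sup>2) / (2 * a)"
      using a by (intro divide_right_mono) auto
    also have "(- 2 * (norm p)\<^sup>2 + 2 * (\<kappa> * (4 * b * norm p + 4 * b\<^sup>2))) / (2 * a) = - (norm p)\<^sup>2 / a + \<kappa> * ((4 * b * norm p + 4 * b\<^sup>2) / a)"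
    proof -
      have "(- 2 * X + 2 * (\<kappa> * Y)) / (2 * a) = - X / a + \<kappa> * (Y / a)" for X Y
        using a by (simp add: field_simps)
      then show ?thesis .
    qed
    also have "(24 * \<kappa>\<^sup>2 * b\<^sup>2 - (norm p)\<^sup>2) / (2 * a) = 12 * \<kappa>\<^sup>2 * b\<^sup>2 / a + - (norm p)\<^sup>2 / (2 * a)"
      using a by (simp add: diff_divide_distrib)
    finally show "exp (- (norm p)\<^sup>2 / a + \<kappa> * ((4 * b * norm p + 4 * b\<^sup>2) / a)) \<le> exp (12 * \<kappa>\<^sup>2 * b\<^sup>2 / a + - (norm p)\<^sup>2 / (2 * a))"
      by simp
  qed (use Z assms(7) in \<open>auto intro!: mult_nonneg_nonneg divide_nonneg_nonneg sum_nonneg\<close>)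
  finally show ?thesis
    unfolding exp_add Z_def p_def by (simp only: mult_ac)
qed

text \<open>The kernel error is integrated against \<open>f\<close>. Its Gaussian majorant has twice
  the variance but the old normalisation, hence mass \<open>2 powr (d / 2)\<close>.\<close>

lemma ou_semigroup_interpolation_error:
  fixes x v :: "real ^ 'd" and s :: "'a \<Rightarrow> real"
    and f :: "(real ^ 'd) \<Rightarrow>\<^sub>C 'k::{banach, second_countable_topology}"
  assumes "t > 0" "finite J" "inj_on s J" "card J = 2 * N" "N \<ge> 1" "norm v \<le> b" "\<kappa> \<ge> 1"
    and s: "\<And>j. j \<in> J \<Longrightarrow> 0 \<le> s j \<and> s j \<le> 2"
  defines "a \<equiv> 1 - exp (- 2 * t)" and "c \<equiv> \<lambda>j. \<Prod>i\<in>J - {j}. s i / (s i - s j)"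
  shows "norm (apply_bcontfun (ou_semigroup t f) x - (\<Sum>j\<in>J. c j *\<^sub>R apply_bcontfun (ou_semigroup t f) (x + s j *\<^sub>R v))) \<le>
    (\<Sum>j\<in>J. \<bar>c j\<bar>) / \<kappa> ^ N * exp (12 * \<kappa>\<^sup>2 * b\<^sup>2 / a) * 2 powr (CARD('d) / 2) * norm f"
proof -
  have a: "a > 0" using assms(1) by (simp add: a_def)
  let ?E = "(\<Sum>j\<in>J. \<bar>c j\<bar>) / \<kappa> ^ N * exp (12 * \<kappa>\<^sup>2 * b\<^sup>2 / a)"
  let ?Z = "1 / (pi powr (CARD('d) / 2) * a powr (CARD('d) / 2))"
  define k where "k = (\<lambda>y. mehler t x y - (\<Sum>j\<in>J. c j * mehler t (x + s j *\<^sub>R v) y))"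
  have int: "integrable lborel (mehler t y)" for y :: "real ^ 'd"
    using has_bochner_integral_mehler[OF assms(1), of y] by (auto simp: has_bochner_integral_iff)
  have k_int: "integrable lborel k"
    unfolding k_def by (intro Bochner_Integration.integrable_diff Bochner_Integration.integrable_sum integrable_mult_right int)
  have "apply_bcontfun (ou_semigroup t f) x - (\<Sum>j\<in>J. c j *\<^sub>R apply_bcontfun (ou_semigroup t f) (x + s j *\<^sub>R v)) =
      (\<integral>y. mehler t x y *\<^sub>R apply_bcontfun f y \<partial>lborel) - (\<Sum>j\<in>J. \<integral>y. (c j * mehler t (x + s j *\<^sub>R v) y) *\<^sub>R apply_bcontfun f y \<partial>lborel)"
    using assms(1) by (simp add: apply_ou_semigroup flip: scaleR_scaleR)
  also have "\<dots> = (\<integral>y. mehler t x y *\<^sub>R apply_bcontfun f y - (\<Sum>j\<in>J. (c j * mehler t (x + s j *\<^sub>R v) y) *\<^sub>R apply_bcontfun f y) \<partial>lborel)"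
    by (subst Bochner_Integration.integral_diff)
      (auto intro!: integrable_scaleR_bcontfun integrable_mult_right int Bochner_Integration.integrable_sum
        Bochner_Integration.integral_sum [symmetric])
  also have "\<dots> = (\<integral>y. k y *\<^sub>R apply_bcontfun f y \<partial>lborel)"
    by (simp add: k_def scaleR_diff_left scaleR_sum_left)
  finally have "norm (apply_bcontfun (ou_semigroup t f) x - (\<Sum>j\<in>J. c j *\<^sub>R apply_bcontfun (ou_semigroup t f) (x + s j *\<^sub>R v)))
      \<le> (\<integral>y. \<bar>k y\<bar> \<partial>lborel) * norm f"
    using integrable_scaleR_bcontfun(2)[OF k_int, of f] by simp
  also have "\<dots> \<le> (?E * 2 powr (CARD('d) / 2)) * norm f"
  proof (rule mult_right_mono)
    have gauss: "has_bochner_integral lborel (\<lambda>y. ?E * (?Z * exp (- (norm (y - exp (- t) *\<^sub>R x))\<^sup>2 / (2 * a))))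
       (?E * (?Z * (pi * (2 * a)) powr (DIM(real ^ 'd) / 2)))"
      using a by (intro has_bochner_integral_mult_right has_bochner_integral_exp_norm_square) auto
    have "(\<integral>y. \<bar>k y\<bar> \<partial>lborel) \<le> (\<integral>y. ?E * (?Z * exp (- (norm (y - exp (- t) *\<^sub>R x))\<^sup>2 / (2 * a))) \<partial>lborel)"
    proof (rule integral_mono)
      show "integrable lborel (\<lambda>y. \<bar>k y\<bar>)" using k_int by simp
      show "integrable lborel (\<lambda>y. ?E * (?Z * exp (- (norm (y - exp (- t) *\<^sub>R x))\<^sup>2 / (2 * a))))"
        using gauss by (simp only: has_bochner_integral_iff)
      show "\<bar>k y\<bar> \<le> ?E * (?Z * exp (- (norm (y - exp (- t) *\<^sub>R x))\<^sup>2 / (2 * a)))" for y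
        using mehler_interpolation_error[OF assms(1-7) s, of x y] unfolding k_def a_def c_def .
    qed
    also have "\<dots> = ?E * (?Z * (pi * (2 * a)) powr (DIM(real ^ 'd) / 2))"
      using gauss by (simp only: has_bochner_integral_iff)
    also have "?Z * (pi * (2 * a)) powr (DIM(real ^ 'd) / 2) = 2 powr (CARD('d) / 2)"
      using a by (simp add: powr_mult)
    finally show "(\<integral>y. \<bar>k y\<bar> \<partial>lborel) \<le> ?E * 2 powr (CARD('d) / 2)" .
  qed simp
  finally show ?thesis .
qed

section \<open>Supremum norms of observations, and the inequality for thick sets\<close>

lemma norm_le_Cb_norm_observation:
  fixes f :: "'a::topological_space \<Rightarrow>\<^sub>C 'k::real_normed_vector"
  assumes "x \<in> \<Omega>"
  shows "norm (apply_bcontfun f x) \<le> Cb_norm \<Omega> (observation \<Omega> f)"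
proof -
  have "bdd_above ((\<lambda>z. norm (observation \<Omega> f z)) ` \<Omega>)"
    using norm_bounded[of f] by (intro bdd_aboveI2[of _ _ "norm f"]) (auto simp: observation_def)
  then have "norm (observation \<Omega> f x) \<le> Cb_norm \<Omega> (observation \<Omega> f)"
    unfolding Cb_norm_def using assms by (intro cSUP_upper)
  then show ?thesis using assms by (simp add: observation_def)
qed

lemma Cb_norm_observation_bounds:
  fixes f :: "'a::topological_space \<Rightarrow>\<^sub>C 'k::real_normed_vector"
  assumes "\<Omega> \<noteq> {}"
  shows "0 \<le> Cb_norm \<Omega> (observation \<Omega> f)" "Cb_norm \<Omega> (observation \<Omega> f) \<le> norm f"
proof -
  obtain x where "x \<in> \<Omega>" using assms by blast
  then show "0 \<le> Cb_norm \<Omega> (observation \<Omega> f)"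
    using norm_le_Cb_norm_observation[of x \<Omega> f] norm_ge_zero order_trans by blast
  show "Cb_norm \<Omega> (observation \<Omega> f) \<le> norm f"
    unfolding Cb_norm_def using assms norm_bounded[of f]
    by (intro cSUP_least) (auto simp: observation_def)
qed

text \<open>By the semigroup law the state at time \<open>t\<close> is the evolution over
  \<open>t - s\<close> of the state \<open>g\<close> at time \<open>s\<close>. Extrapolation from
  \<open>2 * N\<close> nodes in \<open>\<Omega>\<close> costs the sum of the weights times the
  observed norm; the kernel error costs a small multiple of \<open>norm g\<close>.\<close>

lemma thick_interpolation_inequality:
  fixes \<Omega> :: "(real ^ 'd) set"
  assumes "thick \<Omega>" "T > 0"
  obtains c D where "1 \<le> c" "1 \<le> D"
    "\<And>(f :: (real ^ 'd) \<Rightarrow>\<^sub>C 'k::{banach, second_countable_topology}) s t N.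
       \<lbrakk>0 < s; s < t; t \<le> T; 1 \<le> N\<rbrakk> \<Longrightarrow>
       norm (ou_semigroup t f) \<le> exp (c * real N) * Cb_norm \<Omega> (observation \<Omega> (ou_semigroup t f)) +
         D * exp (D / (t - s)) * exp (- 3 * c * real N) * norm (ou_semigroup s f)"
proof -
  obtain b K where b: "0 \<le> b" and K: "0 \<le> K" and nodes:
    "\<And>x n. n \<ge> 1 \<Longrightarrow> \<exists>v m J. norm v \<le> b \<and> J \<subseteq> {..<m} \<and> card J = n \<and> real m \<le> K * real n \<and>
       (\<forall>i\<in>J. x + (1 + real i / real m) *\<^sub>R v \<in> \<Omega>)"
    using thick_nodes[OF assms(1)] by blast
  \<comment> \<open>The sum of the weights is at most \<open>2 * N * exp (4 * m)\<close> with
    \<open>m \<le> 2 * K * N\<close>: the summand 2 pays for the number of nodes,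
    \<open>8 * K\<close> for the exponential.\<close>
  define c where "c = 2 + 8 * K"
  \<comment> \<open>The extrapolation loses \<open>exp (c * N)\<close>, so \<open>\<kappa> ^ N\<close> has to beat this by \<open>exp (3 * c * N)\<close>.\<close>
  define \<kappa> where "\<kappa> = exp (4 * c)"
  \<comment> \<open>Since \<open>a \<ge> 2 * \<tau> * exp (- 2 * T)\<close>, the exponent
    \<open>12 * \<kappa>\<^sup>2 * b\<^sup>2 / a\<close> is at most \<open>E / \<tau>\<close>.
    \<open>D\<close> also dominates the mass \<open>2 powr (d / 2)\<close>.\<close>
  define E where "E = 6 * \<kappa>\<^sup>2 * b\<^sup>2 * exp (2 * T)"
  define D where "D = 1 + 2 powr (CARD('d) / 2) + E"
  have c: "1 \<le> c" using K by (simp add: c_def)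
  have \<kappa>: "1 \<le> \<kappa>" using c by (simp add: \<kappa>_def)
  have E: "0 \<le> E" by (simp add: E_def)
  then have D: "1 \<le> D" by (simp add: D_def)
  show thesis
  proof (rule that[OF c D])
    fix f :: "(real ^ 'd) \<Rightarrow>\<^sub>C 'k" and s t :: real and N :: nat
    assume st: "0 < s" "s < t" "t \<le> T" and N: "1 \<le> N"
    define \<tau> where "\<tau> = t - s"
    define a where "a = 1 - exp (- 2 * \<tau>)"
    have \<tau>: "0 < \<tau>" "\<tau> \<le> T" using st by (auto simp: \<tau>_def)
    have a: "a > 0" using \<tau> by (simp add: a_def)
    define g where "g = ou_semigroup s f"
    define u where "u = ou_semigroup t f"
    have u: "u = ou_semigroup \<tau> g"
      using ou_semigroup_add[of s \<tau> f] st \<tau> by (simp add: u_def g_def \<tau>_def)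
    have a_ge: "2 * \<tau> * exp (- 2 * T) \<le> a"
    proof -
      have "1 + 2 * \<tau> \<le> exp (2 * \<tau>)" by (rule exp_ge_add_one_self)
      then have "exp (- 2 * \<tau>) * (1 + 2 * \<tau>) \<le> exp (- 2 * \<tau>) * exp (2 * \<tau>)" by (intro mult_left_mono) auto
      then have "2 * \<tau> * exp (- 2 * \<tau>) \<le> a" by (simp add: a_def algebra_simps flip: exp_add)
      moreover have "2 * \<tau> * exp (- 2 * T) \<le> 2 * \<tau> * exp (- 2 * \<tau>)"
        using \<tau> by (intro mult_left_mono) auto
      ultimately show ?thesis by linarith
    qed
    have exponent: "12 * \<kappa>\<^sup>2 * b\<^sup>2 / a \<le> D / \<tau>"
    proof -
      have "12 * \<kappa>\<^sup>2 * b\<^sup>2 / a \<le> 12 * \<kappa>\<^sup>2 * b\<^sup>2 / (2 * \<tau> * exp (- 2 * T))"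
        using a_ge \<tau> a by (intro divide_left_mono mult_pos_pos) auto
      also have "\<dots> = E / \<tau>"
        by (simp add: E_def exp_minus field_simps)
      also have "\<dots> \<le> D / \<tau>" using \<tau> by (intro divide_right_mono) (auto simp: D_def)
      finally show ?thesis .
    qed
    have "norm (apply_bcontfun u x) \<le> exp (c * real N) * Cb_norm \<Omega> (observation \<Omega> u) +
         D * exp (D / \<tau>) * exp (- 3 * c * real N) * norm g" for x
    proof -
      obtain v m J where v: "norm v \<le> b" and J: "J \<subseteq> {..<m}" "card J = 2 * N"
        and m: "real m \<le> K * real (2 * N)" and J\<Omega>: "\<And>i. i \<in> J \<Longrightarrow> x + (1 + real i / real m) *\<^sub>R v \<in> \<Omega>"
        using nodes[of "2 * N" x] N by auto
      have fin: "finite J" using J finite_subset by blast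
      \<comment> \<open>From here on \<open>s\<close> names the nodes, which lie between 1 and 2,
        and no longer the earlier time.\<close>
      define s where "s i = 1 + real i / real m" for i
      define w where "w j = (\<Prod>i\<in>J - {j}. s i / (s i - s j))" for j
      have inj: "inj_on s J" using J by (auto simp: inj_on_def s_def)
      have s_le: "0 \<le> s j \<and> s j \<le> 2" if "j \<in> J" for j
        using that J by (auto simp: s_def)
      define W where "W = (\<Sum>j\<in>J. \<bar>w j\<bar>)"
      have "W \<le> real (card J) * exp (4 * real m)"
        unfolding W_def w_def s_def using J(1) by (rule lagrange_coefficient_sum_le)
      also have "\<dots> \<le> exp (real (2 * N)) * exp (8 * K * real N)"
        unfolding J(2) using m by (intro mult_mono less_imp_le[OF exp_gt_self]) auto
      also have "\<dots> = exp (c * real N)"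
        by (simp add: c_def algebra_simps flip: exp_add)
      finally have W: "W \<le> exp (c * real N)" .
      have "W \<ge> 0" by (auto simp: W_def intro: sum_nonneg)
      let ?Cb = "Cb_norm \<Omega> (observation \<Omega> u)"
      have "norm (\<Sum>j\<in>J. w j *\<^sub>R apply_bcontfun u (x + s j *\<^sub>R v)) \<le> (\<Sum>j\<in>J. \<bar>w j\<bar> * ?Cb)"
        using norm_le_Cb_norm_observation[OF J\<Omega>, of _ u]
        by (intro sum_norm_le) (auto simp: s_def intro: mult_left_mono)
      also have "\<dots> = W * ?Cb" by (simp add: W_def sum_distrib_right)
      also have "\<dots> \<le> exp (c * real N) * ?Cb"
        using W Cb_norm_observation_bounds(1)[OF thick_nonempty[OF assms(1)], of u] by (rule mult_right_mono)
      finally have 1: "norm (\<Sum>j\<in>J. w j *\<^sub>R apply_bcontfun u (x + s j *\<^sub>R v)) \<le> exp (c * real N) * ?Cb" .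
      have "norm (apply_bcontfun u x - (\<Sum>j\<in>J. w j *\<^sub>R apply_bcontfun u (x + s j *\<^sub>R v))) \<le>
         W / \<kappa> ^ N * exp (12 * \<kappa>\<^sup>2 * b\<^sup>2 / a) * 2 powr (CARD('d) / 2) * norm g"
        unfolding u W_def w_def a_def
        using ou_semigroup_interpolation_error[OF \<tau>(1) fin inj J(2) N v \<kappa> s_le, of g x] by simp
      also have "\<dots> \<le> exp (- 3 * c * real N) * exp (D / \<tau>) * D * norm g"
      proof (intro mult_right_mono mult_mono)
        have "W / \<kappa> ^ N \<le> exp (c * real N) / \<kappa> ^ N"
          using W \<kappa> by (intro divide_right_mono) auto
        also have "\<dots> = exp (- 3 * c * real N)"
        proof -
          have "\<kappa> ^ N = exp (4 * c * real N)"
            by (simp add: \<kappa>_def mult.commute flip: exp_of_nat_mult)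
          then show ?thesis by (simp flip: exp_diff)
        qed
        finally show "W / \<kappa> ^ N \<le> exp (- 3 * c * real N)" .
      qed (use exponent E D \<kappa> \<open>W \<ge> 0\<close> in \<open>auto simp: D_def\<close>)
      finally have "norm (apply_bcontfun u x - (\<Sum>j\<in>J. w j *\<^sub>R apply_bcontfun u (x + s j *\<^sub>R v))) \<le>
         D * exp (D / \<tau>) * exp (- 3 * c * real N) * norm g"
        by (simp only: mult_ac)
      then show ?thesis
        using 1 norm_triangle_sub[of "apply_bcontfun u x" "\<Sum>j\<in>J. w j *\<^sub>R apply_bcontfun u (x + s j *\<^sub>R v)"] by linarith
    qed
    then show "norm (ou_semigroup t f) \<le> exp (c * real N) * Cb_norm \<Omega> (observation \<Omega> (ou_semigroup t f)) +
         D * exp (D / (t - s)) * exp (- 3 * c * real N) * norm (ou_semigroup s f)"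
      unfolding u_def g_def \<tau>_def by (rule norm_bound)
  qed
qed

section \<open>Telescoping\<close>

text \<open>\<open>F\<close> stands for the norm of the state, \<open>G\<close> for the observed
  norm. Averaging the hypothesis over times just below \<open>T / 2 ^ k\<close> bounds differences
  of weighted values of \<open>F\<close>, and these telescope. The weights tend to 0, so
  \<open>M\<close> removes the last term without entering \<open>C\<close>.\<close>

lemma dyadic_telescoping:
  fixes c D T :: real
  assumes "1 \<le> c" "1 \<le> D" "0 < T"
  obtains C where "0 < C"
    "\<And>(F :: real \<Rightarrow> real) (G :: real \<Rightarrow> real) M. \<lbrakk>\<And>t. 0 \<le> F t; \<And>t. F t \<le> M; \<And>s t. 0 < s \<Longrightarrow> s \<le> t \<Longrightarrow> F t \<le> F s;
        \<And>t. 0 \<le> G t; G integrable_on {0..T};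
        \<And>s t N. \<lbrakk>0 < s; s < t; t \<le> T; 1 \<le> N\<rbrakk> \<Longrightarrow>
          F t \<le> exp (c * real N) * G t + D * exp (D / (t - s)) * exp (- 3 * c * real N) * F s\<rbrakk>
      \<Longrightarrow> F T \<le> C * integral {0..T} G"
proof -
  \<comment> \<open>Chosen so that \<open>D * exp (4 * D * 2 ^ k / T) \<le> exp (K * 2 ^ k)\<close>
    for all \<open>k\<close>, using \<open>D \<le> exp D\<close>.\<close>
  obtain K :: nat where K: "D + 4 * D / T \<le> real K"
    using real_arch_simple by blast
  have K1: "1 \<le> K"
  proof -
    have "0 \<le> 4 * D / T" using assms by simp
    then have "1 \<le> real K" using K assms by linarith
    then show ?thesis by simp
  qed
  \<comment> \<open>The factor \<open>4 / T\<close> comes from averaging in each step; the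
    exponential is the inverse of the first weight \<open>\<alpha> 0\<close>.\<close>
  define C where "C = 4 / T * exp (2 * c * real K)"
  show thesis
  proof (rule that[of C])
    show "0 < C" using assms by (simp add: C_def)
    fix F G :: "real \<Rightarrow> real" and M :: real
    assume F0: "\<And>t. 0 \<le> F t" and FM: "\<And>t. F t \<le> M"
      and F_mono: "\<And>s t. 0 < s \<Longrightarrow> s \<le> t \<Longrightarrow> F t \<le> F s"
      and G0: "\<And>t. 0 \<le> G t" and G: "G integrable_on {0..T}"
      and interp: "\<And>s t N. \<lbrakk>0 < s; s < t; t \<le> T; 1 \<le> N\<rbrakk> \<Longrightarrow>
          F t \<le> exp (c * real N) * G t + D * exp (D / (t - s)) * exp (- 3 * c * real N) * F s"
    \<comment> \<open>The weights satisfy \<open>\<alpha> (Suc k) = (\<alpha> k)\<^sup>2\<close>, which is exactly the coefficient produced by weighting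
      the remainder \<open>exp (- 2 * c * n k) * F (\<tau> (Suc k))\<close> of step \<open>k\<close>.\<close>
    define \<tau> where "\<tau> k = T / 2 ^ k" for k
    define n where "n k = K * 2 ^ k" for k
    define \<alpha> where "\<alpha> k = exp (- 2 * c * real (n k))" for k
    have \<tau>: "0 < \<tau> k" "\<tau> k \<le> T" "\<tau> (Suc k) = \<tau> k / 2" for k
      using assms by (auto simp: \<tau>_def field_simps)
    have G_on: "G integrable_on {a..b}" if "0 \<le> a" "b \<le> T" for a b
      using that by (intro integrable_on_subinterval[OF G]) auto
    have step: "\<alpha> k * F (\<tau> k) - \<alpha> (Suc k) * F (\<tau> (Suc k)) \<le> 4 / T * integral {\<tau> (Suc k)..\<tau> k} G" for k
    proof -
      let ?e = "\<alpha> k * F (\<tau> k) - \<alpha> (Suc k) * F (\<tau> (Suc k))"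
      let ?l = "3 * \<tau> k / 4"
      have n1: "1 \<le> n k" using K1 by (simp add: n_def)
      \<comment> \<open>For these \<open>t\<close> the distance to \<open>\<tau> (Suc k)\<close> is
        at least \<open>\<tau> k / 4\<close>. One of the three factors
        \<open>exp (- c * n k)\<close> therefore pays for
        \<open>D * exp (D / (t - \<tau> (Suc k)))\<close>, and the other two make up
        \<open>\<alpha> k\<close>.\<close>
      have pointwise: "?e \<le> exp (- c * real (n k)) * G t" if t: "t \<in> {?l..\<tau> k}" for t
      proof -
        have "D * exp (D / (t - \<tau> (Suc k))) \<le> exp (real (n k))"
        proof -
          have "t - \<tau> (Suc k) \<ge> \<tau> k / 4" using t by (simp add: \<tau>(3))
          then have "D / (t - \<tau> (Suc k)) \<le> D / (\<tau> k / 4)"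
            using \<tau>(1)[of k] assms by (intro divide_left_mono) auto
          also have "\<dots> = 4 * D / T * 2 ^ k"
            by (simp add: \<tau>_def)
          finally have 1: "D / (t - \<tau> (Suc k)) \<le> 4 * D / T * 2 ^ k" .
          have "D * 1 \<le> D * 2 ^ k" using assms by (intro mult_left_mono) auto
          with 1 have "D + D / (t - \<tau> (Suc k)) \<le> (D + 4 * D / T) * 2 ^ k"
            unfolding distrib_right by linarith
          also have "\<dots> \<le> real K * 2 ^ k"
            using K by (intro mult_right_mono) auto
          finally have "D + D / (t - \<tau> (Suc k)) \<le> real (n k)" by (simp add: n_def)
          moreover have "D * exp (D / (t - \<tau> (Suc k))) \<le> exp D * exp (D / (t - \<tau> (Suc k)))"
            using less_imp_le[OF exp_gt_self] by (intro mult_right_mono) auto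
          ultimately show ?thesis
            by (simp flip: exp_add) (meson dual_order.trans exp_le_cancel_iff)
        qed
        also have "\<dots> \<le> exp (c * real (n k))"
          using assms by (simp add: mult_right_mono[of 1 c "real (n k)", simplified])
        finally have "D * exp (D / (t - \<tau> (Suc k))) * exp (- 3 * c * real (n k)) * F (\<tau> (Suc k)) \<le>
            exp (c * real (n k)) * exp (- 3 * c * real (n k)) * F (\<tau> (Suc k))"
          using F0 by (intro mult_right_mono) auto
        also have "exp (c * real (n k)) * exp (- 3 * c * real (n k)) = \<alpha> k"
          by (simp add: \<alpha>_def flip: exp_add)
        finally have "F t \<le> exp (c * real (n k)) * G t + \<alpha> k * F (\<tau> (Suc k))"
          using interp[OF \<tau>(1) _ _ n1, of "Suc k" t] t \<tau>(1,2)[of k] by (simp add: \<tau>(3))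
        moreover have "F (\<tau> k) \<le> F t"
          using t \<tau>(1)[of k] by (intro F_mono) auto
        ultimately have "\<alpha> k * F (\<tau> k) \<le> \<alpha> k * (exp (c * real (n k)) * G t + \<alpha> k * F (\<tau> (Suc k)))"
          by (intro mult_left_mono) (auto simp: \<alpha>_def)
        also have "\<dots> = (\<alpha> k * exp (c * real (n k))) * G t + (\<alpha> k * \<alpha> k) * F (\<tau> (Suc k))"
          by (simp add: algebra_simps)
        also have "\<alpha> k * exp (c * real (n k)) = exp (- c * real (n k))"
          by (simp add: \<alpha>_def flip: exp_add)
        also have "\<alpha> k * \<alpha> k = \<alpha> (Suc k)"
          by (simp add: \<alpha>_def n_def algebra_simps flip: exp_add)
        finally show ?thesis by simp
      qed
      \<comment> \<open>The interval has length \<open>\<tau> k / 4\<close>. Afterwards the integral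
        of \<open>G\<close> is enlarged to start at \<open>\<tau> (Suc k)\<close>, so that
        consecutive intervals abut.\<close>
      have "integral {?l..\<tau> k} (\<lambda>_. ?e) \<le> integral {?l..\<tau> k} (\<lambda>t. exp (- c * real (n k)) * G t)"
        using pointwise G_on[of ?l "\<tau> k"] \<tau>(1,2)[of k]
        by (intro integral_le integrable_on_cmult_left Henstock_Kurzweil_Integration.integrable_const_ivl) auto
      then have "\<tau> k / 4 * ?e \<le> exp (- c * real (n k)) * integral {?l..\<tau> k} G"
        using \<tau>(1)[of k] by (simp add: mult.commute)
      also have "\<dots> \<le> exp (- c * real (n k)) * integral {\<tau> (Suc k)..\<tau> k} G"
        using \<tau>(1,2)[of k] \<tau>(3)[of k] G0
        by (intro mult_left_mono integral_subset_le G_on) auto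
      finally have "\<tau> k / 4 * ?e \<le> exp (- c * real (n k)) * integral {\<tau> (Suc k)..\<tau> k} G" .
      then have "4 / \<tau> k * (\<tau> k / 4 * ?e) \<le> 4 / \<tau> k * (exp (- c * real (n k)) * integral {\<tau> (Suc k)..\<tau> k} G)"
        using \<tau>(1)[of k] by (intro mult_left_mono) auto
      also have "4 / \<tau> k * (\<tau> k / 4 * ?e) = ?e"
        using \<tau>(1)[of k] by simp
      also have "4 / \<tau> k * (exp (- c * real (n k)) * integral {\<tau> (Suc k)..\<tau> k} G) =
          4 / T * (2 ^ k * exp (- c * real (n k))) * integral {\<tau> (Suc k)..\<tau> k} G"
        by (simp add: \<tau>_def)
      also have "\<dots> \<le> 4 / T * 1 * integral {\<tau> (Suc k)..\<tau> k} G"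
      proof (intro mult_right_mono mult_left_mono)
        \<comment> \<open>Dividing by the interval length brings in \<open>2 ^ k\<close>, which the
          remaining \<open>exp (- c * n k)\<close> absorbs.\<close>
        have "(2::real) ^ k \<le> exp (2 ^ k)" by (intro less_imp_le exp_gt_self)
        also have "\<dots> \<le> exp (c * real (n k))"
        proof -
          have "1 * 2 ^ k \<le> (c * real K) * 2 ^ k"
            using assms K1 mult_mono[of 1 c 1 "real K"] by (intro mult_right_mono) auto
          then show ?thesis by (simp add: n_def mult.assoc)
        qed
        finally show "2 ^ k * exp (- c * real (n k)) \<le> 1"
          by (simp add: exp_minus field_simps)
      qed (use assms G0 in \<open>auto intro!: Henstock_Kurzweil_Integration.integral_nonneg G_on simp: \<tau> less_imp_le\<close>)
      finally show ?thesis by simp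
    qed
    have telescope: "\<alpha> 0 * F T - \<alpha> m * F (\<tau> m) \<le> 4 / T * integral {\<tau> m..T} G" for m
    proof (induction m)
      case 0
      then show ?case by (simp add: \<tau>_def)
    next
      case (Suc m)
      have "integral {\<tau> (Suc m)..\<tau> m} G + integral {\<tau> m..T} G = integral {\<tau> (Suc m)..T} G"
        using \<tau>(1)[of "Suc m"] \<tau>(1,2)[of m] \<tau>(3)[of m]
        by (intro Henstock_Kurzweil_Integration.integral_combine G_on) auto
      then have "4 / T * integral {\<tau> (Suc m)..T} G = 4 / T * integral {\<tau> (Suc m)..\<tau> m} G + 4 / T * integral {\<tau> m..T} G"
        by (simp only: distrib_left [symmetric])
      then show ?case using Suc.IH step[of m] by linarith
    qed
    have "\<alpha> 0 * F T \<le> 4 / T * integral {0..T} G + \<alpha> m * M" for m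
    proof -
      have "integral {\<tau> m..T} G \<le> integral {0..T} G"
        using \<tau>(1,2)[of m] G0 by (intro integral_subset_le G_on) auto
      then have "4 / T * integral {\<tau> m..T} G \<le> 4 / T * integral {0..T} G"
        using assms by (intro mult_left_mono) auto
      moreover have "\<alpha> m * F (\<tau> m) \<le> \<alpha> m * M"
        using FM by (intro mult_left_mono) (auto simp: \<alpha>_def)
      ultimately show ?thesis using telescope[of m] by linarith
    qed
    moreover have "(\<lambda>m. 4 / T * integral {0..T} G + \<alpha> m * M) \<longlonglongrightarrow> 4 / T * integral {0..T} G + 0 * M"
    proof (intro tendsto_intros)
      have "filterlim n at_top sequentially"
      proof (rule filterlim_at_top_mono[OF filterlim_ident])
        have "m \<le> n m" for m
        proof -
          have "1 * m \<le> K * 2 ^ m" using K1 by (intro mult_mono less_imp_le[OF less_exp]) auto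
          then show ?thesis by (simp add: n_def)
        qed
        then show "\<forall>\<^sub>F m in sequentially. m \<le> n m" by simp
      qed
      then have "filterlim (\<lambda>m. 2 * c * real (n m)) at_top sequentially"
        using assms by (intro filterlim_tendsto_pos_mult_at_top[OF tendsto_const] filterlim_compose[OF filterlim_real_sequentially]) auto
      then have "filterlim (\<lambda>m. - (2 * c * real (n m))) at_bot sequentially"
        by (simp only: filterlim_uminus_at_top)
      then show "\<alpha> \<longlonglongrightarrow> 0"
        unfolding \<alpha>_def using filterlim_compose[OF exp_at_bot] by simp
    qed
    ultimately have "\<alpha> 0 * F T \<le> 4 / T * integral {0..T} G"
      by (intro LIMSEQ_le_const) auto
    then have "exp (2 * c * real K) * (\<alpha> 0 * F T) \<le> exp (2 * c * real K) * (4 / T * integral {0..T} G)"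
      by (intro mult_left_mono) auto
    also have "exp (2 * c * real K) * (\<alpha> 0 * F T) = F T"
      by (simp add: \<alpha>_def n_def flip: exp_add mult.assoc)
    also have "exp (2 * c * real K) * (4 / T * integral {0..T} G) = C * integral {0..T} G"
      by (simp add: C_def)
    finally show "F T \<le> C * integral {0..T} G" .
  qed
qed

section \<open>Final-state observability\<close>

text \<open>By continuity in space, the supremum over \<open>\<Omega>\<close> is one over a
  countable dense subset, and at each single point the dependence on time is measurable as a
  parameter integral.\<close>

lemma borel_measurable_Cb_norm_ou_semigroup:
  fixes \<Omega> :: "(real ^ 'd) set" and f :: "(real ^ 'd) \<Rightarrow>\<^sub>C 'k::{banach, second_countable_topology}"
  assumes "\<Omega> \<noteq> {}"
  shows "(\<lambda>t. Cb_norm \<Omega> (observation \<Omega> (ou_semigroup t f))) \<in> borel_measurable borel"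
proof -
  obtain D where D: "countable D" "D \<subseteq> \<Omega>" "\<Omega> \<subseteq> closure D"
    by (rule separable)
  have "D \<noteq> {}" using D assms by auto
  have f_meas [measurable]: "apply_bcontfun f \<in> borel_measurable borel"
    by (intro borel_measurable_continuous_onI continuous_on_apply_bcontfun)
  \<comment> \<open>The value 0 for \<open>t \<le> 0\<close> keeps \<open>H\<close> below the norm
    of the state at all times. At those times the observed norm is constant and is treated
    separately.\<close>
  define H where "H x t = (if 0 < t then norm (\<integral>y. mehler t x y *\<^sub>R apply_bcontfun f y \<partial>lborel) else 0)"
    for x :: "real ^ 'd" and t :: real
  have H: "H x t = norm (apply_bcontfun (ou_semigroup t f) x)" if "0 < t" for x t
    using that by (simp add: H_def apply_ou_semigroup)
  have H_le: "H x t \<le> norm (ou_semigroup t f)" for x t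
  proof (cases "0 < t")
    case True
    then show ?thesis using norm_bounded[of "ou_semigroup t f" x] by (simp add: H)
  qed (simp add: H_def)
  have H_meas: "H x \<in> borel_measurable borel" for x
  proof -
    have "(\<lambda>(t, y). mehler t x y *\<^sub>R apply_bcontfun f y) \<in> borel_measurable (borel \<Otimes>\<^sub>M lborel)"
      unfolding mehler_def by measurable
    then have "(\<lambda>t. \<integral>y. mehler t x y *\<^sub>R apply_bcontfun f y \<partial>lborel) \<in> borel_measurable borel"
      by (rule lborel.borel_measurable_lebesgue_integral)
    then show ?thesis unfolding H_def by measurable
  qed
  have bdd: "bdd_above ((\<lambda>x. H x t) ` D)" for t
    using H_le by (intro bdd_aboveI2)
  have "Cb_norm \<Omega> (observation \<Omega> (ou_semigroup t f)) =
      (if 0 < t then SUP x\<in>D. H x t else Cb_norm \<Omega> (observation \<Omega> f))" for t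
  proof (cases "0 < t")
    case True
    let ?u = "ou_semigroup t f"
    have "Cb_norm \<Omega> (observation \<Omega> ?u) \<le> (SUP x\<in>D. H x t)"
      unfolding Cb_norm_def
    proof (rule cSUP_least [OF assms])
      fix z assume z: "z \<in> \<Omega>"
      have "D \<subseteq> {x. norm (apply_bcontfun ?u x) \<le> (SUP x\<in>D. H x t)}"
        using cSUP_upper[OF _ bdd[of t]] by (auto simp: H[OF True, symmetric])
      moreover have "closed {x. norm (apply_bcontfun ?u x) \<le> (SUP x\<in>D. H x t)}"
        by (intro closed_Collect_le continuous_intros continuous_on_apply_bcontfun)
      ultimately have "closure D \<subseteq> {x. norm (apply_bcontfun ?u x) \<le> (SUP x\<in>D. H x t)}"
        by (rule closure_minimal)
      then show "norm (observation \<Omega> ?u z) \<le> (SUP x\<in>D. H x t)"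
        using D z by (auto simp: observation_def)
    qed
    moreover have "(SUP x\<in>D. H x t) \<le> Cb_norm \<Omega> (observation \<Omega> ?u)"
      using D \<open>D \<noteq> {}\<close> by (intro cSUP_least) (auto simp: H[OF True] intro!: norm_le_Cb_norm_observation)
    ultimately show ?thesis using True by simp
  qed (simp add: ou_semigroup_def)
  moreover have "(\<lambda>t. SUP x\<in>D. H x t) \<in> borel_measurable borel"
    using D bdd by (intro borel_measurable_cSUP H_meas) auto
  ultimately show ?thesis by simp
qed

text \<open>Comparison of the L^1 norm with the L^p norm. The factor
  \<open>measure M (space M) + 1\<close> is cruder than the power of the measure from Hoelder's
  inequality, but independent of \<open>p\<close>.\<close>

lemma (in finite_measure) integral_le_powr_mean:
  fixes G :: "'a \<Rightarrow> real"
  assumes "integrable M G" "integrable M (\<lambda>x. G x powr p)" "\<And>x. 0 \<le> G x" "1 \<le> p"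
  shows "(\<integral>x. G x \<partial>M) \<le> (measure M (space M) + 1) * (\<integral>x. G x powr p \<partial>M) powr (1 / p)"
proof -
  let ?I = "\<integral>x. G x powr p \<partial>M" and ?V = "measure M (space M)"
  have le: "(\<integral>x. G x \<partial>M) \<le> l * ?V + l powr (1 - p) * ?I" if l: "0 < l" for l
  proof -
    \<comment> \<open>A substitute for Hoelder's inequality; it is optimised with \<open>l\<close> the \<open>L\<^sup>p\<close>-norm of \<open>G\<close>.\<close>
    have "G x \<le> l + l powr (1 - p) * G x powr p" for x
    proof (cases "G x \<le> l")
      case True
      then show ?thesis by (simp add: add_increasing2)
    next
      case False
      then have "G x = G x powr (1 - p) * G x powr p"
        using l by (simp flip: powr_add)
      also have "\<dots> \<le> l powr (1 - p) * G x powr p"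
        using False l assms(4) by (intro mult_right_mono powr_mono2') auto
      finally show ?thesis using l by simp
    qed
    then have "(\<integral>x. G x \<partial>M) \<le> (\<integral>x. l + l powr (1 - p) * G x powr p \<partial>M)"
      using assms by (intro integral_mono) auto
    also have "\<dots> = l * ?V + l powr (1 - p) * ?I"
      using assms(2) by simp
    finally show ?thesis .
  qed
  show ?thesis
  proof (cases "?I = 0")
    case True
    \<comment> \<open>Here the L^p norm is 0 and cannot serve as \<open>l\<close>, so
      \<open>l\<close> is taken arbitrarily small instead.\<close>
    have "(\<integral>x. G x \<partial>M) \<le> 0 + e" if "0 < e" for e
    proof -
      have "(\<integral>x. G x \<partial>M) \<le> e / (?V + 1) * ?V"
        using le[of "e / (?V + 1)"] that True by (simp add: add_nonneg_pos)
      also have "\<dots> \<le> e"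
      proof -
        have "e * ?V \<le> e * (?V + 1)" using that by (intro mult_left_mono) auto
        then show ?thesis by (simp add: divide_le_eq add_nonneg_pos)
      qed
      finally show ?thesis by simp
    qed
    then show ?thesis using True by (auto intro: field_le_epsilon)
  next
    case False
    moreover have "0 \<le> ?I" by simp
    ultimately have I: "0 < ?I" by linarith
    have "1 / p * (1 - p) + 1 = 1 / p" using assms(4) by (simp add: field_simps)
    moreover have "(?I powr (1 / p)) powr (1 - p) * ?I = ?I powr (1 / p * (1 - p) + 1)"
      unfolding powr_powr powr_add using I by simp
    ultimately have "(?I powr (1 / p)) powr (1 - p) * ?I = ?I powr (1 / p)"
      by (simp only:)
    then show ?thesis
      using le[of "?I powr (1 / p)"] I by (simp only: distrib_right) (simp add: mult.commute)
  qed
qed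

text \<open>The interpolation inequality is fed into the telescoping argument. Integrability of the
  powers is recorded as well: the Bochner integral of a non-integrable function is 0, so the passage
  to other exponents depends on it.\<close>

lemma ou_final_state_observability_L1:
  fixes \<Omega> :: "(real ^ 'd) set"
  assumes "thick \<Omega>" "0 < T"
  obtains C where "0 < C"
    "\<And>f :: (real ^ 'd) \<Rightarrow>\<^sub>C 'k::{banach, second_countable_topology}. norm (ou_semigroup T f) \<le>
      C * (\<integral>t. Cb_norm \<Omega> (observation \<Omega> (ou_semigroup t f)) \<partial>lebesgue_on {0..T})"
    "\<And>(f :: (real ^ 'd) \<Rightarrow>\<^sub>C 'k) p. 0 \<le> p \<Longrightarrow>
      integrable (lebesgue_on {0..T}) (\<lambda>t. Cb_norm \<Omega> (observation \<Omega> (ou_semigroup t f)) powr p)"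
proof -
  obtain c D where c: "1 \<le> c" and D: "1 \<le> D" and interp:
    "\<And>(f :: (real ^ 'd) \<Rightarrow>\<^sub>C 'k) s t N. \<lbrakk>0 < s; s < t; t \<le> T; 1 \<le> N\<rbrakk> \<Longrightarrow>
       norm (ou_semigroup t f) \<le> exp (c * real N) * Cb_norm \<Omega> (observation \<Omega> (ou_semigroup t f)) +
         D * exp (D / (t - s)) * exp (- 3 * c * real N) * norm (ou_semigroup s f)"
    by (rule thick_interpolation_inequality[OF assms]) blast
  obtain C where C: "0 < C" and tele:
    "\<And>(F :: real \<Rightarrow> real) (G :: real \<Rightarrow> real) M. \<lbrakk>\<And>t. 0 \<le> F t; \<And>t. F t \<le> M; \<And>s t. 0 < s \<Longrightarrow> s \<le> t \<Longrightarrow> F t \<le> F s;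
        \<And>t. 0 \<le> G t; G integrable_on {0..T};
        \<And>s t N. \<lbrakk>0 < s; s < t; t \<le> T; 1 \<le> N\<rbrakk> \<Longrightarrow>
          F t \<le> exp (c * real N) * G t + D * exp (D / (t - s)) * exp (- 3 * c * real N) * F s\<rbrakk>
      \<Longrightarrow> F T \<le> C * integral {0..T} G"
    by (rule dyadic_telescoping[OF c D assms(2)]) blast
  show thesis
  proof (rule that[OF C])
    show int: "integrable (lebesgue_on {0..T}) (\<lambda>t. Cb_norm \<Omega> (observation \<Omega> (ou_semigroup t f)) powr p)"
      if "0 \<le> p" for f :: "(real ^ 'd) \<Rightarrow>\<^sub>C 'k" and p
    proof -
      interpret finite_measure "lebesgue_on {0..T}"
        by (intro finite_measure_lebesgue_on) simp
      have G: "0 \<le> Cb_norm \<Omega> (observation \<Omega> (ou_semigroup t f))"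
        "Cb_norm \<Omega> (observation \<Omega> (ou_semigroup t f)) \<le> norm f" for t
        using Cb_norm_observation_bounds[OF thick_nonempty[OF assms(1)], of "ou_semigroup t f"] norm_ou_semigroup_le[of t f]
        by auto
      have "(\<lambda>t. Cb_norm \<Omega> (observation \<Omega> (ou_semigroup t f)) powr p) \<in> borel_measurable borel"
        using borel_measurable_Cb_norm_ou_semigroup[OF thick_nonempty[OF assms(1)], of f] by measurable
      then have "(\<lambda>t. Cb_norm \<Omega> (observation \<Omega> (ou_semigroup t f)) powr p) \<in> borel_measurable (lebesgue_on {0..T})"
        by (intro measurable_restrict_space1 measurable_completion) simp
      then show ?thesis
        using that G by (intro integrable_const_bound[of _ "norm f powr p"]) (auto intro!: powr_mono2)
    qed
    fix f :: "(real ^ 'd) \<Rightarrow>\<^sub>C 'k"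
    let ?G = "\<lambda>t. Cb_norm \<Omega> (observation \<Omega> (ou_semigroup t f))"
    have G: "0 \<le> ?G t" for t
      using Cb_norm_observation_bounds[OF thick_nonempty[OF assms(1)]] by auto
    then have G_int: "integrable (lebesgue_on {0..T}) ?G"
      using int[of 1 f] by simp
    have "norm (ou_semigroup T f) \<le> C * integral {0..T} ?G"
    proof (rule tele[of "\<lambda>t. norm (ou_semigroup t f)" "norm f"])
      \<comment> \<open>The norm decreases in time by the semigroup law and contractivity; the law
        is for positive times, so \<open>s = t\<close> is a separate case.\<close>
      show "norm (ou_semigroup t f) \<le> norm (ou_semigroup s f)" if "0 < s" "s \<le> t" for s t
        using ou_semigroup_add[of s "t - s" f] norm_ou_semigroup_le[of "t - s" "ou_semigroup s f"] that
        by (cases "s = t") auto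
      show "?G integrable_on {0..T}"
        by (rule integrable_on_lebesgue_on[OF G_int]) simp
    qed (use G interp norm_ou_semigroup_le in auto)
    then show "norm (ou_semigroup T f) \<le> C * (\<integral>t. ?G t \<partial>lebesgue_on {0..T})"
      using lebesgue_integral_eq_integral[OF G_int] by simp
  qed
qed

theorem mainTheorem3:
  fixes \<Omega> :: "(real ^ 'd) set" and T :: real and r :: ereal
  assumes "thick \<Omega>" and "T > 0" and "1 \<le> r"
  shows "\<exists>C\<^sub>o\<^sub>b\<^sub>s \<ge> 0. \<forall>f :: (real ^ 'd) \<Rightarrow>\<^sub>C 'k::{real_normed_field, euclidean_space}.
    (if r < \<infinity>
     then norm (ou_semigroup T f) \<le>
       C\<^sub>o\<^sub>b\<^sub>s * (\<integral>t. Cb_norm \<Omega> (observation \<Omega> (ou_semigroup t f)) powr real_of_ereal r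
         \<partial>lebesgue_on {0..T}) powr (1 / real_of_ereal r)
     else ereal (norm (ou_semigroup T f)) \<le>
       ereal C\<^sub>o\<^sub>b\<^sub>s * esssup (lebesgue_on {0..T})
         (\<lambda>t. ereal (Cb_norm \<Omega> (observation \<Omega> (ou_semigroup t f)))))"
proof -
  obtain C where C: "0 < C"
    and L1: "\<And>f :: (real ^ 'd) \<Rightarrow>\<^sub>C 'k. norm (ou_semigroup T f) \<le>
      C * (\<integral>t. Cb_norm \<Omega> (observation \<Omega> (ou_semigroup t f)) \<partial>lebesgue_on {0..T})"
    and int: "\<And>(f :: (real ^ 'd) \<Rightarrow>\<^sub>C 'k) p. 0 \<le> p \<Longrightarrow>
      integrable (lebesgue_on {0..T}) (\<lambda>t. Cb_norm \<Omega> (observation \<Omega> (ou_semigroup t f)) powr p)"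
    by (rule ou_final_state_observability_L1[OF assms(1,2)]) blast
  interpret finite_measure "lebesgue_on {0..T}"
    by (intro finite_measure_lebesgue_on) simp
  have space: "measure (lebesgue_on {0..T}) (space (lebesgue_on {0..T})) = T"
    using assms(2) by (simp add: measure_restrict_space)
  show ?thesis
  \<comment> \<open>One constant serves every \<open>r\<close>: \<open>T + 1\<close> is the factor
    in the comparison with L^p, and it exceeds the factor \<open>T\<close> that arises from the
    essential supremum.\<close>
  proof (intro exI[of _ "C * (T + 1)"] conjI allI)
    show "0 \<le> C * (T + 1)" using C assms(2) by simp
    fix f :: "(real ^ 'd) \<Rightarrow>\<^sub>C 'k"
    let ?G = "\<lambda>t. Cb_norm \<Omega> (observation \<Omega> (ou_semigroup t f))"
    have G: "0 \<le> ?G t" for t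
      using Cb_norm_observation_bounds[OF thick_nonempty[OF assms(1)]] by auto
    then have G_int: "integrable (lebesgue_on {0..T}) ?G"
      using int[of 1 f] by simp
    have "norm (ou_semigroup T f) \<le> C * (T + 1) * (\<integral>t. ?G t powr real_of_ereal r \<partial>lebesgue_on {0..T}) powr (1 / real_of_ereal r)"
      if "r < \<infinity>"
    proof -
      have p: "1 \<le> real_of_ereal r" using assms(3) that by (cases r) auto
      have "(\<integral>t. ?G t \<partial>lebesgue_on {0..T}) \<le> (T + 1) * (\<integral>t. ?G t powr real_of_ereal r \<partial>lebesgue_on {0..T}) powr (1 / real_of_ereal r)"
        using integral_le_powr_mean[OF G_int int G p] p unfolding space by simp
      then show ?thesis
        using L1[of f] C by (simp add: mult.assoc) (meson mult_left_mono less_imp_le order_trans)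
    qed
    moreover have "ereal (norm (ou_semigroup T f)) \<le> ereal (C * (T + 1)) * esssup (lebesgue_on {0..T}) (\<lambda>t. ereal (?G t))"
    \<comment> \<open>The essential supremum is an extended real. If it is infinite the bound is
      trivial, because the constant is positive.\<close>
    proof (cases "esssup (lebesgue_on {0..T}) (\<lambda>t. ereal (?G t))")
      case (real e)
      have "AE t in lebesgue_on {0..T}. ?G t \<le> e"
        using esssup_AE[of "\<lambda>t. ereal (?G t)" "lebesgue_on {0..T}"] unfolding real by simp
      then have "(\<integral>t. ?G t \<partial>lebesgue_on {0..T}) \<le> (\<integral>t. e \<partial>lebesgue_on {0..T})"
        by (intro integral_mono_AE G_int) auto
      also have "\<dots> = T * e" using space by simp
      finally have 1: "(\<integral>t. ?G t \<partial>lebesgue_on {0..T}) \<le> T * e" .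
      moreover have "0 \<le> (\<integral>t. ?G t \<partial>lebesgue_on {0..T})" using G by simp
      ultimately have "0 \<le> T * e" by linarith
      then have "0 \<le> e" using assms(2) by (simp add: zero_le_mult_iff)
      have "norm (ou_semigroup T f) \<le> C * (T * e)"
        using L1[of f] mult_left_mono[OF 1, of C] C by linarith
      also have "\<dots> \<le> C * (T + 1) * e"
        using C \<open>0 \<le> e\<close> by (simp add: algebra_simps)
      finally show ?thesis unfolding real by simp
    next
      case PInf
      then show ?thesis using C assms(2) by simp
    next
      case MInf
      \<comment> \<open>An essential supremum of minus infinity would make the time interval a null
        set, although its measure is \<open>T > 0\<close>.\<close>
      have "AE t in lebesgue_on {0..T}. False"
        using esssup_AE[of "\<lambda>t. ereal (?G t)" "lebesgue_on {0..T}"] unfolding MInf by simp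
      then have "emeasure (lebesgue_on {0..T}) (space (lebesgue_on {0..T})) = 0"
        using AE_iff_measurable[of "space (lebesgue_on {0..T})" "lebesgue_on {0..T}" "\<lambda>_. False"]
        by (simp only: sets.top not_False_eq_True simp_thms Collect_mem_eq)
      then show ?thesis using space assms(2) by (simp add: measure_def)
    qed
    ultimately show "if r < \<infinity>
     then norm (ou_semigroup T f) \<le>
       C * (T + 1) * (\<integral>t. ?G t powr real_of_ereal r \<partial>lebesgue_on {0..T}) powr (1 / real_of_ereal r)
     else ereal (norm (ou_semigroup T f)) \<le> ereal (C * (T + 1)) * esssup (lebesgue_on {0..T}) (\<lambda>t. ereal (?G t))"
      by simp
  qed
qed

end
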